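(* Let $I=(\mathbf{x}^{\mathbf{a}_1},\dots,\mathbf{x}^{\mathbf{a}_d})\subseteq R$. The following statements are equivalent: (a) $\deg(\mathbf{a}_{d+j})\geq 1$ for every $j=1,\dots,s$; (b) $I$ is a reduction ideal of $\mathfrak{m}$. If these statements hold, then the reduction number of $\mathfrak{m}$ with respect to $I$ is at most $sl-1$, where $l=\max\{e_1,\dots,e_s\}$.
   Context: Let $d\ge 1$, let $\mathbb{N}$ be the set of non-negative integers, and let $S\subseteq\mathbb{N}^d$ be an affine (finitely generated) semigroup containing $\mathbf 0$, fully embedded in $\mathbb{N}^d$ (i.e. of dimension $d$: $S$ spans $\mathbb{R}^d$), and simplicial: the cone $\mathrm{cone}(S)\subseteq\mathbb{R}^d_{\ge0}$ of non-negative real combinations of elements of $S$ has exactly $d$ extremal rays. Its minimal generating set is $\{\mathbf{a}_1,\dots,\mathbf{a}_{d+s}\}$, where $\mathbf{a}_1,\dots,\mathbf{a}_d$ are the extremal rays of $S$, i.e. the smallest nonzero elements of $S$ lying on each of the $d$ extremal rays of the cone; they are $\mathbb{Q}$-linearly independent and $S\subseteq\sum_{i=1}^d\mathbb{Q}_{\ge 0}\mathbf{a}_i$. For $\mathbf{a}\in\mathbb{N}^d\cap\mathrm{cone}(S)$ write uniquely $\mathbf{a}=\sum_{i=1}^d l_i\mathbf{a}_i$ with $l_i\in\mathbb{Q}_{\geq0}$ and set $\deg(\mathbf{a})=\sum_{i=1}^d l_i$. For $j=1,\dots,s$ let $c_j$ be the smallest positive integer with $c_j\mathbf{a}_{d+j}\in\sum_{i=1}^d\mathbb{N}\mathbf{a}_i$,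 write uniquely $c_j\mathbf{a}_{d+j}=\sum_{i=1}^d l_{j_i}\mathbf{a}_i$ with $l_{j_i}\in\mathbb{N}$, and set $e_j=\sum_{i=1}^d l_{j_i}$. Let $\mathbb{K}$ be a field. For $\mathbf a=(a_1,\dots,a_d)\in\mathbb{N}^d$ put $\mathbf{x}^{\mathbf{a}}=x_1^{a_1}\cdots x_d^{a_d}$. Let $R=\mathbb{K}[S]=\mathbb{K}[\mathbf{x}^{\mathbf{a}_1},\dots,\mathbf{x}^{\mathbf{a}_{d+s}}]\subseteq\mathbb{K}[x_1,\dots,x_d]$ and $\mathfrak{m}=(\mathbf{x}^{\mathbf{a}_1},\dots,\mathbf{x}^{\mathbf{a}_{d+s}})$. An ideal $J\subseteq\mathfrak{m}$ of $R$ is a reduction ideal of $\mathfrak{m}$ if $\mathfrak{m}^{n+1}=J\mathfrak{m}^n$ for $n\gg0$; it is a minimal reduction ideal if it is minimal among reduction ideals with respect to inclusion (if $I$ is a reduction ideal it is automatically minimal). The reduction number of $\mathfrak m$ with respect to a minimal reduction $J$ is the smallest positive integer $r$ such that $\mathfrak{m}^{n+1}=J\mathfrak{m}^n$ for all $n\geq r$. *)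

theory Defs
  imports
    "HOL-Analysis.Analysis"
    "HOL-Library.Poly_Mapping"
    "HOL-Algebra.Ideal_Product"
    "HOL-Algebra.Generated_Rings"
begin

text \<open>
  The ambient monoid is \<^typ>\<open>nat ^ 'd\<close> with \<open>d = CARD('d)\<close>. A family of generators
  \<open>a\<^sub>1, \<dots>, a\<^sub>d\<^sub>+\<^sub>s\<close> is a function on \<^typ>\<open>nat\<close> of which only the values on
  \<open>{1..CARD('d) + s}\<close> matter.
\<close>

definition real_vec :: "nat ^ 'd \<Rightarrow> real ^ 'd" where
  "real_vec v = (\<chi> k. real (v $ k))"

definition nat_span :: "(nat ^ 'd) set \<Rightarrow> (nat ^ 'd) set" where
  "nat_span A = {(\<Sum>v\<in>F. n v *s v) | F n. finite F \<and> F \<subseteq> A}"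

definition affine_semigroup :: "(nat ^ 'd) set \<Rightarrow> bool" where
  "affine_semigroup S \<longleftrightarrow> (\<exists>A. finite A \<and> S = nat_span A)"

definition minimal_generating_set :: "(nat ^ 'd) set \<Rightarrow> (nat ^ 'd) set \<Rightarrow> bool" where
  "minimal_generating_set S A \<longleftrightarrow> nat_span A = S \<and> (\<forall>B. B \<subset> A \<longrightarrow> nat_span B \<noteq> S)"

definition fully_embedded :: "(nat ^ 'd) set \<Rightarrow> bool" where
  "fully_embedded S \<longleftrightarrow> span (real_vec ` S) = UNIV"

definition cone_of :: "(nat ^ 'd) set \<Rightarrow> (real ^ 'd) set" where
  "cone_of S = {(\<Sum>v\<in>F. c v *\<^sub>R real_vec v) | F c. finite F \<and> F \<subseteq> S \<and> (\<forall>v\<in>F. 0 \<le> c v)}"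

text \<open>
  The cone lies in the non-negative orthant, hence contains no line and has the apex \<open>0\<close> in
  each nonempty face; its one-dimensional faces are therefore exactly its extremal rays.
\<close>

definition extremal_rays :: "(nat ^ 'd) set \<Rightarrow> (real ^ 'd) set set" where
  "extremal_rays S = {F. F face_of cone_of S \<and> aff_dim F = 1}"

definition simplicial :: "(nat ^ 'd) set \<Rightarrow> bool" where
  "simplicial S \<longleftrightarrow> card (extremal_rays S) = CARD('d)"

text \<open>
  The smallest nonzero elements of \<open>S\<close> on the extremal rays; the componentwise order
  is total on each ray.
\<close>

definition extremal_generators :: "(nat ^ 'd) set \<Rightarrow> (nat ^ 'd) set" where
  "extremal_generators S =
     {v \<in> S. v \<noteq> 0 \<and> (\<exists>F \<in> extremal_rays S. real_vec v \<in> F \<and>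
        (\<forall>w\<in>S. w \<noteq> 0 \<and> real_vec w \<in> F \<longrightarrow> v \<le> w))}"

text \<open>
  \<^const>\<open>PiE\<close> makes the coordinate functions \<^const>\<open>undefined\<close> outside \<open>{1..CARD('d)}\<close>,
  so that they are unique as functions whenever \<open>a\<^sub>1, \<dots>, a\<^sub>d\<close> are linearly independent.
\<close>

definition rat_coords :: "(nat \<Rightarrow> nat ^ 'd) \<Rightarrow> nat ^ 'd \<Rightarrow> nat \<Rightarrow> rat" where
  "rat_coords a v = (THE l. l \<in> {1..CARD('d)} \<rightarrow>\<^sub>E {0..} \<and>
     (\<forall>k. of_nat (v $ k) = (\<Sum>i\<in>{1..CARD('d)}. l i * of_nat (a i $ k))))"

definition deg :: "(nat \<Rightarrow> nat ^ 'd) \<Rightarrow> nat ^ 'd \<Rightarrow> rat" where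
  "deg a v = (\<Sum>i\<in>{1..CARD('d)}. rat_coords a v i)"

definition nat_coords :: "(nat \<Rightarrow> nat ^ 'd) \<Rightarrow> nat ^ 'd \<Rightarrow> nat \<Rightarrow> nat" where
  "nat_coords a v = (THE l. l \<in> {1..CARD('d)} \<rightarrow>\<^sub>E UNIV \<and>
     v = (\<Sum>i\<in>{1..CARD('d)}. l i *s a i))"

definition c_num :: "(nat \<Rightarrow> nat ^ 'd) \<Rightarrow> nat \<Rightarrow> nat" where
  "c_num a j = (LEAST c. 0 < c \<and> c *s a (CARD('d) + j) \<in> nat_span (a ` {1..CARD('d)}))"

definition e_num :: "(nat \<Rightarrow> nat ^ 'd) \<Rightarrow> nat \<Rightarrow> nat" where
  "e_num a j = (\<Sum>i\<in>{1..CARD('d)}. nat_coords a (c_num a j *s a (CARD('d) + j)) i)"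

text \<open>
  \<^typ>\<open>(nat ^ 'd) \<Rightarrow>\<^sub>0 'k\<close>, with the convolution product of \<^theory>\<open>HOL-Library.Poly_Mapping\<close>,
  is the polynomial ring over \<open>'k\<close> in variables indexed by \<open>'d\<close>; exponent vectors are the keys.
\<close>

definition poly_ring :: "((nat ^ 'd) \<Rightarrow>\<^sub>0 'k::field) ring" where
  "poly_ring = \<lparr>carrier = UNIV, mult = (*), one = 1, zero = 0, add = (+)\<rparr>"

definition monomial :: "nat ^ 'd \<Rightarrow> (nat ^ 'd) \<Rightarrow>\<^sub>0 'k::field" where
  "monomial v = Poly_Mapping.single v 1"

definition semigroup_ring :: "(nat ^ 'd) set \<Rightarrow> ((nat ^ 'd) \<Rightarrow>\<^sub>0 'k::field) ring" where
  "semigroup_ring S = poly_ring\<lparr>carrier := {f. Poly_Mapping.keys f \<subseteq> S}\<rparr>"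

text \<open>
  Powers of ideals are taken in the monoid \<^term>\<open>ideals_set R\<close>, whose product is
  \<^const>\<open>ideal_prod\<close> and whose unit is the whole ring.
\<close>

definition reduction_ideal :: "('r, 'm) ring_scheme \<Rightarrow> 'r set \<Rightarrow> 'r set \<Rightarrow> bool" where
  "reduction_ideal R M J \<longleftrightarrow> ideal J R \<and> J \<subseteq> M \<and>
     (\<forall>\<^sub>F n in sequentially. M [^]\<^bsub>ideals_set R\<^esub> (n + 1) = J \<cdot>\<^bsub>R\<^esub> (M [^]\<^bsub>ideals_set R\<^esub> n))"

text \<open>
  Minimality of \<open>J\<close> plays no role in the formula, so it is not built into the definition.
\<close>

definition reduction_number :: "('r, 'm) ring_scheme \<Rightarrow> 'r set \<Rightarrow> 'r set \<Rightarrow> nat" where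
  "reduction_number R M J = (LEAST r. 0 < r \<and>
     (\<forall>n\<ge>r. M [^]\<^bsub>ideals_set R\<^esub> (n + 1) = J \<cdot>\<^bsub>R\<^esub> (M [^]\<^bsub>ideals_set R\<^esub> n)))"

lemma real_vec_0 [simp]: "real_vec 0 = 0"
  by (simp add: real_vec_def vec_eq_iff)

lemma cone_of_eq_hull: "cone_of S = convex_cone hull (real_vec ` S)"
proof (rule hull_unique[symmetric])
  show "real_vec ` S \<subseteq> cone_of S"
  proof
    fix x assume "x \<in> real_vec ` S"
    then obtain v where v: "v \<in> S" "x = real_vec v" by blast
    have "x = (\<Sum>w\<in>{v}. (\<lambda>_. 1) w *\<^sub>R real_vec w)" using v by simp
    then show "x \<in> cone_of S" unfolding cone_of_def using v(1)
      by (intro CollectI exI[of _ "{v}"] exI[of _ "\<lambda>_. 1"]) auto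
  qed
  show "convex_cone (cone_of S)"
    unfolding convex_cone_iff
  proof (intro conjI ballI allI impI)
    have "0 = (\<Sum>w\<in>{}. (\<lambda>_. 1) w *\<^sub>R real_vec w)" by simp
    then show "0 \<in> cone_of S" unfolding cone_of_def by fastforce
  next
    fix x y assume "x \<in> cone_of S" "y \<in> cone_of S"
    then obtain F c G b where
      x: "x = (\<Sum>v\<in>F. c v *\<^sub>R real_vec v)" "finite F" "F \<subseteq> S" "\<forall>v\<in>F. 0 \<le> c v" and
      y: "y = (\<Sum>v\<in>G. b v *\<^sub>R real_vec v)" "finite G" "G \<subseteq> S" "\<forall>v\<in>G. 0 \<le> b v"
      unfolding cone_of_def by blast
    define h where "h v = (if v \<in> F then c v else 0) + (if v \<in> G then b v else 0)" for v
    have "x = (\<Sum>v\<in>F \<union> G. (if v \<in> F then c v else 0) *\<^sub>R real_vec v)"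
      unfolding x(1) by (rule sum.mono_neutral_cong_left) (use x y in auto)
    moreover have "y = (\<Sum>v\<in>F \<union> G. (if v \<in> G then b v else 0) *\<^sub>R real_vec v)"
      unfolding y(1) by (rule sum.mono_neutral_cong_left) (use x y in auto)
    ultimately have "x + y = (\<Sum>v\<in>F \<union> G. h v *\<^sub>R real_vec v)"
      unfolding h_def scaleR_add_left sum.distrib by simp
    moreover have "\<forall>v\<in>F \<union> G. 0 \<le> h v" using x(4) y(4) by (auto simp: h_def)
    ultimately show "x + y \<in> cone_of S" unfolding cone_of_def
      using x(2,3) y(2,3) by (intro CollectI exI[of _ "F \<union> G"] exI[of _ h]) auto
  next
    fix x :: "real ^ 'a" and t :: real assume "x \<in> cone_of S" "0 \<le> t"
    then obtain F c where
      x: "x = (\<Sum>v\<in>F. c v *\<^sub>R real_vec v)" "finite F" "F \<subseteq> S" "\<forall>v\<in>F. 0 \<le> c v"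
      unfolding cone_of_def by blast
    have "t *\<^sub>R x = (\<Sum>v\<in>F. (t * c v) *\<^sub>R real_vec v)"
      unfolding x(1) by (simp add: scaleR_sum_right)
    then show "t *\<^sub>R x \<in> cone_of S" unfolding cone_of_def
      using x(2-4) \<open>0 \<le> t\<close> by (intro CollectI exI[of _ F] exI[of _ "\<lambda>v. t * c v"]) auto
  qed
next
  fix T assume T: "real_vec ` S \<subseteq> T" "convex_cone T"
  show "cone_of S \<subseteq> T"
  proof
    fix x assume "x \<in> cone_of S"
    then obtain F c where
      x: "x = (\<Sum>v\<in>F. c v *\<^sub>R real_vec v)" "finite F" "F \<subseteq> S" "\<forall>v\<in>F. 0 \<le> c v"
      unfolding cone_of_def by blast
    have "(\<Sum>v\<in>F. c v *\<^sub>R real_vec v) \<in> T" using x(2-4)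
    proof (induction F)
      case empty
      then show ?case using convex_cone_contains_0[OF T(2)] by simp
    next
      case (insert v F)
      then show ?case using T
        by (auto intro!: convex_cone_add convex_cone_scaleR)
    qed
    then show "x \<in> T" by (simp add: x(1))
  qed
qed

lemma nat_span_zero: "0 \<in> nat_span A"
  unfolding nat_span_def by (intro CollectI exI[of _ "{}"]) simp

lemma nat_span_base: "v \<in> A \<Longrightarrow> v \<in> nat_span A"
  unfolding nat_span_def
  by (intro CollectI exI[of _ "{v}"] exI[of _ "\<lambda>_. 1"]) (simp add: vec_eq_iff)

lemma nat_span_add:
  assumes "x \<in> nat_span A" "y \<in> nat_span A"
  shows "x + y \<in> nat_span A"
proof -
  from assms obtain F c G b where
    x: "x = (\<Sum>v\<in>F. c v *s v)" "finite F" "F \<subseteq> A" and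
    y: "y = (\<Sum>v\<in>G. b v *s v)" "finite G" "G \<subseteq> A"
    unfolding nat_span_def by blast
  define h where "h v = (if v \<in> F then c v else 0) + (if v \<in> G then b v else 0)" for v
  have "x = (\<Sum>v\<in>F \<union> G. (if v \<in> F then c v else 0) *s v)"
    unfolding x(1) by (rule sum.mono_neutral_cong_left) (use x y in \<open>auto simp: vec_eq_iff\<close>)
  moreover have "y = (\<Sum>v\<in>F \<union> G. (if v \<in> G then b v else 0) *s v)"
    unfolding y(1) by (rule sum.mono_neutral_cong_left) (use x y in \<open>auto simp: vec_eq_iff\<close>)
  ultimately have "x + y = (\<Sum>v\<in>F \<union> G. h v *s v)"
    by (simp add: h_def sum.distrib[symmetric] vec_eq_iff distrib_right)
  then show ?thesis unfolding nat_span_def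
    using x(2,3) y(2,3) by (intro CollectI exI[of _ "F \<union> G"] exI[of _ h]) auto
qed

lemma cring_poly_ring: "cring (poly_ring :: ((nat ^ 'd) \<Rightarrow>\<^sub>0 'k::field) ring)"
proof (rule cringI)
  show "abelian_group (poly_ring :: ((nat ^ 'd) \<Rightarrow>\<^sub>0 'k::field) ring)"
  proof (rule abelian_groupI)
    fix x :: "(nat ^ 'd) \<Rightarrow>\<^sub>0 'k"
    show "\<exists>y\<in>carrier poly_ring. y \<oplus>\<^bsub>poly_ring\<^esub> x = \<zero>\<^bsub>poly_ring\<^esub>"
      by (rule bexI[of _ "- x"]) (simp_all add: poly_ring_def)
  qed (simp_all add: poly_ring_def ac_simps)
  show "comm_monoid (poly_ring :: ((nat ^ 'd) \<Rightarrow>\<^sub>0 'k::field) ring)"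
    by (rule comm_monoidI) (simp_all add: poly_ring_def ac_simps)
qed (simp_all add: poly_ring_def distrib_right)

lemma a_inv_poly_ring: "\<ominus>\<^bsub>poly_ring\<^esub> f = - f"
proof -
  interpret cring "poly_ring :: ((nat ^ 'a) \<Rightarrow>\<^sub>0 'b::field) ring" by (rule cring_poly_ring)
  show ?thesis by (rule minus_equality) (simp_all add: poly_ring_def)
qed

lemma carrier_semigroup_ring_eq_generate:
  assumes "nat_span A = S"
  shows "carrier (semigroup_ring S :: ((nat ^ 'd) \<Rightarrow>\<^sub>0 'k::field) ring) =
    generate_ring poly_ring (range (Poly_Mapping.single 0) \<union> monomial ` A)" (is "?L = ?G")
proof
  have [simp]: "mult poly_ring = ((*) :: ((nat ^ 'd) \<Rightarrow>\<^sub>0 'k) \<Rightarrow> _)"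
    "add poly_ring = ((+) :: ((nat ^ 'd) \<Rightarrow>\<^sub>0 'k) \<Rightarrow> _)" "one poly_ring = (1 :: (nat ^ 'd) \<Rightarrow>\<^sub>0 'k)"
    by (simp_all add: poly_ring_def)
  note ga = eng_add[where R = "poly_ring :: ((nat ^ 'd) \<Rightarrow>\<^sub>0 'k) ring", simplified]
  note gm = eng_mult[where R = "poly_ring :: ((nat ^ 'd) \<Rightarrow>\<^sub>0 'k) ring", simplified]
  show "?G \<subseteq> ?L"
  proof
    fix f assume "f \<in> ?G"
    then show "f \<in> ?L"
    proof induction
      case one
      then show ?case using nat_span_zero[of A] assms
        by (simp add: semigroup_ring_def)
    next
      case (incl h)
      then show ?case using nat_span_zero[of A] nat_span_base[of _ A] assms
        by (auto simp: semigroup_ring_def monomial_def split: if_splits)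
    next
      case (a_inv h)
      then show ?case by (simp add: semigroup_ring_def a_inv_poly_ring)
    next
      case (eng_add f g)
      then show ?case using Poly_Mapping.keys_add[of f g] by (auto simp: semigroup_ring_def)
    next
      case (eng_mult f g)
      then show ?case using keys_mult[of f g] nat_span_add[of _ A] assms
        unfolding semigroup_ring_def by (simp add: subset_iff) blast
    qed
  qed
  show "?L \<subseteq> ?G"
  proof
    fix f :: "(nat ^ 'd) \<Rightarrow>\<^sub>0 'k" assume "f \<in> ?L"
    then have f: "Poly_Mapping.keys f \<subseteq> S" by (simp add: semigroup_ring_def)
    have const: "Poly_Mapping.single 0 c \<in> ?G" for c by (rule generate_ring.incl) auto
    have mon_n: "Poly_Mapping.single (n *s v) (1::'k) \<in> ?G" if "v \<in> A" for n v
    proof (induction n)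
      case 0
      then show ?case using const[of 1] by (simp add: vec_eq_iff vector_scalar_mult_def zero_vec_def)
    next
      case (Suc n)
      have "Poly_Mapping.single v (1::'k) \<in> ?G"
        using that by (intro generate_ring.incl) (auto simp: monomial_def)
      then have "Poly_Mapping.single v (1::'k) * Poly_Mapping.single (n *s v) 1 \<in> ?G"
        using Suc by (rule gm)
      moreover have "v + n *s v = Suc n *s v" by (simp add: vec_eq_iff)
      ultimately show ?case by (simp add: mult_single)
    qed
    have mon: "Poly_Mapping.single v (1::'k) \<in> ?G" if vS: "v \<in> S" for v
    proof -
      from vS obtain F n where v: "v = (\<Sum>w\<in>F. n w *s w)" "finite F" "F \<subseteq> A"
        using assms unfolding nat_span_def by blast
      have "Poly_Mapping.single (\<Sum>w\<in>F. n w *s w) (1::'k) \<in> ?G" using v(2,3)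
      proof (induction F)
        case empty
        then show ?case using const[of 1] by simp
      next
        case (insert w F)
        then have "Poly_Mapping.single (n w *s w) (1::'k) *
            Poly_Mapping.single (\<Sum>w\<in>F. n w *s w) 1 \<in> ?G"
          using mon_n[of w "n w"] by (intro gm) auto
        then show ?case using insert by (simp add: mult_single)
      qed
      then show ?thesis by (simp add: v(1))
    qed
    have single: "Poly_Mapping.single v c \<in> ?G" if "v \<in> S" for v c
      using gm[OF const[of c] mon[OF that]] by (simp add: mult_single)
    have sums: "(\<Sum>v\<in>F. Poly_Mapping.single v (Poly_Mapping.lookup f v)) \<in> ?G"
      if "finite F" "F \<subseteq> S" for F
      using that
    proof (induction F)
      case empty
      then show ?case using const[of 0] by simp
    next
      case (insert v F)
      then show ?case by (auto intro!: ga single)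
    qed
    have "f = (\<Sum>v\<in>Poly_Mapping.keys f. Poly_Mapping.single v (Poly_Mapping.lookup f v))"
      by (rule poly_mapping_eqI) (simp add: lookup_sum lookup_single when_def in_keys_iff)
    also have "\<dots> \<in> ?G" by (rule sums[OF finite_keys f])
    finally show "f \<in> ?G" .
  qed
qed

end

theory Submission
  imports Defs
begin

text \<open>
  An ideal of \<open>\<bbbK>[S]\<close> spanned by monomials is determined by its set of exponents, and products of
  ideals become sums of such sets (\<open>ideal_prod_supported\<close>). The \<open>n\<close>-th power of the maximal
  ideal consists of the polynomials whose exponents are sums of at least \<open>n\<close> generators
  (\<open>power_maximal_ideal\<close>). Hence \<open>I\<close> is a reduction iff, for large \<open>n\<close>, every sum of at
  least \<open>n + 1\<close> generators can be rewritten as such a sum in which an extremal ray occurs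
  (\<open>reduction_step_iff\<close>).

  The degree decides whether this rewriting is possible. It is additive and equals \<open>1\<close> on the
  extremal rays. If the rewriting is always possible from \<open>n\<^sub>0\<close> on, then a sum of \<open>n\<^sub>0 + k\<close>
  generators has degree at least \<open>k\<close>; for large multiples of a single generator this forces the
  degree of that generator to be at least \<open>1\<close> (\<open>deg_ge_1_of_reduction\<close>). Conversely, if all
  degrees are at least \<open>1\<close>, then \<open>e\<^sub>j = c\<^sub>j deg a\<^sub>d\<^sub>+\<^sub>j \<ge> c\<^sub>j\<close>, so exchanging \<open>c\<^sub>j\<close> copies of
  \<open>a\<^sub>d\<^sub>+\<^sub>j\<close> for \<open>e\<^sub>j\<close> extremal rays never shortens a sum. A sum of at least
  \<open>s (l - 1) + 1\<close> generators without extremal rays contains some \<open>a\<^sub>d\<^sub>+\<^sub>j\<close> at least \<open>l\<close>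
  times by the pigeonhole principle, so the exchange is possible there
  (\<open>reduction_step_of_deg_ge_1\<close>). For \<open>s \<ge> 1\<close> this covers all \<open>n \<ge> s l - 1\<close>. As
  reduction numbers are positive by definition, the bound also rests on \<open>s l - 1 > 0\<close>, which holds
  because every \<open>e\<^sub>j\<close> is at least \<open>2\<close> (\<open>e_num_bounds\<close>).

  For the degree to exist, the extremal generators must be linearly independent and their cone must
  contain \<open>S\<close>. A compact section of the cone of \<open>S\<close> is the convex hull of its extreme points,
  and these lie on extremal rays, so the extremal generators generate the cone
  (\<open>cone_of_extremal_generators\<close>). Since \<open>S\<close> spans the space, the \<open>d\<close> extremal
  generators form a basis of it (\<open>simplicial_generatorsI\<close>).
\<close>

section \<open>The cone is generated by the extremal generators\<close>

definition height :: "real ^ 'd \<Rightarrow> real" where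
  "height x = (\<Sum>k\<in>UNIV. x $ k)"

lemma height_add: "height (x + y) = height x + height y"
  by (simp add: height_def sum.distrib)

lemma height_scaleR: "height (c *\<^sub>R x) = c * height x"
  by (simp add: height_def sum_distrib_left)

lemma height_pos:
  assumes "\<And>k. 0 \<le> x $ k" "x \<noteq> 0"
  shows "0 < height x"
proof -
  obtain k where "x $ k \<noteq> 0" using assms(2) by (auto simp: vec_eq_iff)
  then have "0 < x $ k" using assms(1)[of k] by simp
  then show ?thesis unfolding height_def
    by (intro sum_pos2[of UNIV k]) (auto simp: assms(1))
qed

text \<open>
  Rescaling both summands to height one writes \<open>x\<close> as a convex combination of two points of the
  section of the cone at height one. As \<open>x\<close> is extreme, these points coincide with it.
\<close>
lemma extreme_point_summand:
  assumes C: "convex_cone C" "\<And>y k. y \<in> C \<Longrightarrow> 0 \<le> y $ k"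
    and x: "x extreme_point_of (C \<inter> {y. height y = 1})"
    and yz: "x = y + z" "y \<in> C" "z \<in> C"
  shows "y = height y *\<^sub>R x"
proof -
  have hx: "height x = 1" using x by (auto simp: extreme_point_of_def)
  consider "y = 0" | "z = 0" | "y \<noteq> 0" "z \<noteq> 0" by blast
  then show ?thesis
  proof cases
    case 1 then show ?thesis by (simp add: height_def)
  next
    case 2 then show ?thesis using yz hx by simp
  next
    case 3
    define s t where "s = height y" and "t = height z"
    have s: "0 < s" using height_pos[of y] C(2) yz(2) 3 by (auto simp: s_def)
    have t: "0 < t" using height_pos[of z] C(2) yz(3) 3 by (auto simp: t_def)
    have st: "s + t = 1" using hx yz(1) by (simp add: s_def t_def height_add)
    define p q where "p = (1/s) *\<^sub>R y" and "q = (1/t) *\<^sub>R z"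
    have p: "p \<in> C \<inter> {y. height y = 1}"
      using s yz(2) convex_cone_scaleR[OF C(1), of "1/s" y] by (simp add: p_def height_scaleR s_def)
    have q: "q \<in> C \<inter> {y. height y = 1}"
      using t yz(3) convex_cone_scaleR[OF C(1), of "1/t" z] by (simp add: q_def height_scaleR t_def)
    have "1 - t = s" using st by simp
    then have eq: "x = (1 - t) *\<^sub>R p + t *\<^sub>R q"
      using s t by (simp add: p_def q_def yz(1))
    have "p = q"
    proof (rule ccontr)
      assume "p \<noteq> q"
      then have "x \<in> open_segment p q"
        using eq s t st by (auto simp: in_segment intro!: exI[of _ t])
      then show False using x p q by (auto simp: extreme_point_of_def)
    qed
    then have "x = p" using eq by (simp add: scaleR_left_diff_distrib)
    then show ?thesis using s by (simp add: p_def s_def[symmetric])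
  qed
qed

text \<open>
  An extreme point of the section spans an extremal ray. A point \<open>t *\<^sub>R x\<close> of the ray
  inside an open segment is a positive combination of the two end points; dividing by \<open>t\<close>
  gives a splitting of \<open>x\<close>, to which the previous lemma applies.
\<close>
lemma extreme_point_ray_face:
  assumes C: "convex_cone C" "\<And>y k. y \<in> C \<Longrightarrow> 0 \<le> y $ k"
    and x: "x extreme_point_of (C \<inter> {y. height y = 1})"
  shows "{t *\<^sub>R x | t. 0 \<le> t} face_of C" and "aff_dim ({t *\<^sub>R x | t. 0 \<le> t}) = 1"
proof -
  let ?F = "{t *\<^sub>R x | t. 0 \<le> t}"
  have xC: "x \<in> C" and hx: "height x = 1" using x by (auto simp: extreme_point_of_def)
  have x0: "x \<noteq> 0" using hx by (auto simp: height_def)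
  show "?F face_of C" unfolding face_of_def
  proof (intro conjI ballI impI)
    show "{t *\<^sub>R x | t. 0 \<le> t} \<subseteq> C" using convex_cone_scaleR[OF C(1)] xC by auto
    show "convex {t *\<^sub>R x | t. 0 \<le> t}"
    proof (rule convexI)
      fix y z :: "real ^ 'a" and u v :: real assume y: "y \<in> {t *\<^sub>R x | t. 0 \<le> t}" and z: "z \<in> {t *\<^sub>R x | t. 0 \<le> t}"
        and uv: "0 \<le> u" "0 \<le> v"
      obtain t t' where "y = t *\<^sub>R x" "z = t' *\<^sub>R x" "0 \<le> t" "0 \<le> t'" using y z by blast
      then show "u *\<^sub>R y + v *\<^sub>R z \<in> {t *\<^sub>R x | t. 0 \<le> t}" using uv
        by (intro CollectI exI[of _ "u * t + v * t'"]) (simp add: scaleR_left_distrib)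
    qed
    have key: "b \<in> {t *\<^sub>R x | t. 0 \<le> t}"
      if w: "w \<in> {t *\<^sub>R x | t. 0 \<le> t}" "w = u *\<^sub>R b + v *\<^sub>R c" "b \<in> C" "c \<in> C" "0 < u" "0 < v"
      for w b c :: "real ^ 'a" and u v
    proof -
      obtain t where t: "w = t *\<^sub>R x" "0 \<le> t" using w(1) by blast
      have hb: "0 \<le> height b" "b \<noteq> 0 \<Longrightarrow> 0 < height b" if "b \<in> C" for b :: "real ^ 'a"
        using that height_pos[of b] C(2) by (auto simp: height_def sum_nonneg)
      show ?thesis
      proof (cases "b = 0")
        case True then show ?thesis by (intro CollectI exI[of _ 0]) simp
      next
        case False
        have "t = u * height b + v * height c"
          using arg_cong[OF w(2), of height] t hx by (simp add: height_add height_scaleR)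
        moreover have "0 < u * height b" using False hb(2)[OF w(3)] w(5) by simp
        moreover have "0 \<le> v * height c" using hb(1)[OF w(4)] w(6) by simp
        ultimately have t0: "0 < t" by linarith
        have "(1/t) *\<^sub>R w = x" using t t0 by simp
        then have "x = (u/t) *\<^sub>R b + (v/t) *\<^sub>R c" using w(2) by (simp add: scaleR_right_distrib)
        from extreme_point_summand[OF C x this] 
        have "(u/t) *\<^sub>R b = height ((u/t) *\<^sub>R b) *\<^sub>R x"
          using w t0 by (simp add: convex_cone_scaleR[OF C(1)])
        then have "(u/t) *\<^sub>R b = (u/t) *\<^sub>R (height b *\<^sub>R x)" by (simp add: height_scaleR)
        then have "b = height b *\<^sub>R x" using w(5) t0 unfolding scaleR_cancel_left by simp
        then show ?thesis using hb(1)[OF w(3)] by blast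
      qed
    qed
    fix b c w assume *: "b \<in> C" "c \<in> C" "w \<in> {t *\<^sub>R x | t. 0 \<le> t}" "w \<in> open_segment b c"
    then obtain u where u: "0 < u" "u < 1" "w = (1 - u) *\<^sub>R b + u *\<^sub>R c" by (auto simp: in_segment)
    then have u': "w = u *\<^sub>R c + (1 - u) *\<^sub>R b" by simp
    show "b \<in> {t *\<^sub>R x | t. 0 \<le> t}" using key[OF *(3) u(3) *(1,2)] u by simp
    show "c \<in> {t *\<^sub>R x | t. 0 \<le> t}" using key[OF *(3) u' *(2,1)] u by simp
  qed
  have "{0, x} \<subseteq> ?F" by (auto intro: exI[of _ 0] exI[of _ 1])
  then have "1 \<le> aff_dim ?F" using aff_dim_subset[of "{0,x}" ?F] x0 by (simp add: aff_dim_2)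
  moreover have "?F \<subseteq> affine hull {0, x}"
    unfolding affine_hull_2
  proof clarify
    fix t :: real
    show "\<exists>u v. t *\<^sub>R x = u *\<^sub>R 0 + v *\<^sub>R x \<and> u + v = 1" by (intro exI[of _ "1 - t"] exI[of _ t]) simp
  qed
  then have "aff_dim ?F \<le> 1"
    using aff_dim_subset[of ?F "affine hull {0, x}"] x0 by (simp add: aff_dim_affine_hull aff_dim_2)
  ultimately show "aff_dim ?F = 1" by simp
qed

lemma real_vec_nat_span: 
  assumes "v \<in> nat_span A"
  shows "real_vec v \<in> cone_of A"
proof -
  obtain F n where F: "v = (\<Sum>w\<in>F. n w *s w)" "finite F" "F \<subseteq> A"
    using assms unfolding nat_span_def by blast
  have "real_vec v = (\<Sum>w\<in>F. real (n w) *\<^sub>R real_vec w)"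
    by (simp add: F(1) real_vec_def vec_eq_iff)
  then show ?thesis unfolding cone_of_def using F by fastforce
qed

lemma cone_of_nat_span: "cone_of (nat_span A) = cone_of A"
  unfolding cone_of_eq_hull
proof (rule antisym)
  show "convex_cone hull real_vec ` nat_span A \<subseteq> convex_cone hull real_vec ` A"
    using real_vec_nat_span[of _ A]
    by (intro hull_minimal) (auto simp: cone_of_eq_hull convex_cone_convex_cone_hull)
  show "convex_cone hull real_vec ` A \<subseteq> convex_cone hull real_vec ` nat_span A"
    using nat_span_base by (intro hull_mono) blast
qed

lemma cone_of_nonneg:
  assumes "y \<in> cone_of S"
  shows "0 \<le> y $ k"
  using assms by (auto simp: cone_of_def real_vec_def intro!: sum_nonneg)

text \<open>
  Finitely generated cones are closed, and the \<open>l\<^sub>1\<close> norm of a non-negative vector is its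
  height.
\<close>
lemma compact_cone_section:
  assumes "finite A"
  shows "compact (cone_of A \<inter> {y. height y = 1})"
  unfolding compact_eq_bounded_closed
proof
  have "closed {y :: real ^ 'a. height y = 1}"
    unfolding height_def by (intro closed_Collect_eq continuous_intros)
  then show "closed (cone_of A \<inter> {y. height y = 1})"
    using assms by (intro closed_Int) (simp_all add: cone_of_eq_hull closed_convex_cone_hull)
  have "norm y \<le> 1" if "y \<in> cone_of A" "height y = 1" for y
    using norm_le_l1_cart[of y] that cone_of_nonneg[OF that(1)] by (simp add: height_def)
  then show "bounded (cone_of A \<inter> {y. height y = 1})" unfolding bounded_iff by blast
qed

text \<open>
  Two elements of the same ray are comparable, and the height orders them; so an element of least
  height is least in the componentwise order.
\<close>
lemma extremal_generator_on_ray: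
  assumes F: "F \<in> extremal_rays S" "F = {t *\<^sub>R x | t. 0 \<le> t}"
    and x: "\<And>k. 0 \<le> x $ k" and w: "w \<in> S" "w \<noteq> 0" "real_vec w \<in> F"
  obtains v t where "v \<in> extremal_generators S" "0 \<le> t" "x = t *\<^sub>R real_vec v"
proof -
  define P where "P v \<longleftrightarrow> v \<in> S \<and> v \<noteq> 0 \<and> real_vec v \<in> F" for v
  define v where "v = arg_min (\<lambda>v. \<Sum>k\<in>UNIV. v $ k) P"
  have "P w" using w by (simp add: P_def)
  then have v: "P v" and vmin: "\<And>u. P u \<Longrightarrow> (\<Sum>k\<in>UNIV. v $ k) \<le> (\<Sum>k\<in>UNIV. u $ k)"
    using arg_min_nat_lemma[of P w "\<lambda>v. \<Sum>k\<in>UNIV. v $ k"] by (simp_all only: v_def)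
  have h: "height (real_vec u) = real (\<Sum>k\<in>UNIV. u $ k)" for u :: "nat ^ 'a"
    by (simp add: height_def real_vec_def)
  obtain t where t: "real_vec v = t *\<^sub>R x" "0 \<le> t" using v unfolding P_def F(2) by blast
  have "v \<noteq> 0" using v by (simp add: P_def)
  then have rv0: "real_vec v \<noteq> 0" by (auto simp: real_vec_def vec_eq_iff)
  then have t0: "0 < t" "x \<noteq> 0" using t by (auto simp: less_le)
  have "v \<le> u" if u: "P u" for u
  proof -
    obtain t' where t': "real_vec u = t' *\<^sub>R x" "0 \<le> t'" using u unfolding P_def F(2) by blast
    have "height (real_vec v) \<le> height (real_vec u)" using vmin[OF u] by (simp only: h of_nat_le_iff)
    then have "t * height x \<le> t' * height x" by (simp add: t t' height_scaleR)
    then have "t \<le> t'" using height_pos[OF x t0(2)] by simp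
    then have "real_vec v $ k \<le> real_vec u $ k" for k
      unfolding t t' using x[of k] by (simp add: mult_right_mono)
    then show ?thesis by (simp add: less_eq_vec_def real_vec_def)
  qed
  then have "v \<in> extremal_generators S"
    using v F(1) unfolding extremal_generators_def P_def by blast
  moreover have "x = (1 / t) *\<^sub>R real_vec v" using t t0 by simp
  ultimately show thesis using t0 by (intro that[of v "1 / t"]) auto
qed

text \<open>
  By the theorem of Krein, Milman and Minkowski the compact section at height one is the convex hull
  of its extreme points, so it suffices that each extreme point \<open>x\<close> is a multiple of an
  extremal generator. The ray of \<open>x\<close> is extremal; it meets the semigroup, because some term of
  any expression of \<open>x\<close> through elements of the semigroup is nonzero and lies on it.
\<close>
lemma cone_of_extremal_generators:
  assumes "affine_semigroup S"
  shows "cone_of S \<subseteq> cone_of (extremal_generators S)"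
proof
  fix y assume y: "y \<in> cone_of S"
  obtain A where A: "finite A" "S = nat_span A" using assms by (auto simp: affine_semigroup_def)
  define K where "K = cone_of S \<inter> {y. height y = 1}"
  have cc: "convex_cone (cone_of T)" for T :: "(nat ^ 'a) set"
    by (simp add: cone_of_eq_hull convex_cone_convex_cone_hull)
  have "compact K" using compact_cone_section[OF A(1)] by (simp add: K_def A(2) cone_of_nat_span)
  moreover have "convex K" unfolding K_def
  proof (intro convex_Int)
    show "convex (cone_of S)" using cc by (auto simp: convex_cone_def)
    show "convex {y :: real ^ 'a. height y = 1}"
      by (rule convexI) (simp add: height_add height_scaleR)
  qed
  ultimately have KM: "K = convex hull {x. x extreme_point_of K}" by (rule Krein_Milman_Minkowski)
  have ext: "x \<in> cone_of (extremal_generators S)" if x: "x extreme_point_of K" for x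
  proof -
    note x' = x[unfolded K_def]
    define F where "F = {t *\<^sub>R x | t. 0 \<le> t}"
    have F: "F \<in> extremal_rays S"
      using extreme_point_ray_face[OF cc cone_of_nonneg x'] by (simp add: F_def extremal_rays_def)
    have xC: "x \<in> cone_of S" "height x = 1" using x' by (auto simp: extreme_point_of_def)
    then obtain G c where G: "x = (\<Sum>v\<in>G. c v *\<^sub>R real_vec v)" "finite G" "G \<subseteq> S" "\<forall>v\<in>G. 0 \<le> c v"
      unfolding cone_of_def by blast
    have "\<exists>w\<in>G. c w *\<^sub>R real_vec w \<noteq> 0"
    proof (rule ccontr)
      assume "\<not> (\<exists>w\<in>G. c w *\<^sub>R real_vec w \<noteq> 0)"
      then have "x = 0" unfolding G(1) by (intro sum.neutral) blast
      then show False using xC(2) by (simp add: height_def)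
    qed
    then obtain w where w: "w \<in> G" "c w \<noteq> 0" "real_vec w \<noteq> 0" by auto
    have cw: "0 < c w" using w G(4) by (auto simp: less_le)
    have split: "x = c w *\<^sub>R real_vec w + (\<Sum>v\<in>G - {w}. c v *\<^sub>R real_vec v)"
      using G w by (simp add: sum.remove)
    have "c w *\<^sub>R real_vec w \<in> cone_of S"
      using w G cw by (simp add: cone_of_eq_hull convex_cone_hull_mul hull_inc subset_iff)
    moreover have "(\<Sum>v\<in>G - {w}. c v *\<^sub>R real_vec v) \<in> cone_of S"
      unfolding cone_of_def using G by blast
    ultimately have "c w *\<^sub>R real_vec w = height (c w *\<^sub>R real_vec w) *\<^sub>R x"
      using extreme_point_summand[OF cc cone_of_nonneg x' split] by simp
    then have "c w *\<^sub>R real_vec w = c w *\<^sub>R (height (real_vec w) *\<^sub>R x)" by (simp add: height_scaleR)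
    then have "real_vec w = height (real_vec w) *\<^sub>R x" using cw unfolding scaleR_cancel_left by simp
    moreover have "0 \<le> height (real_vec w)" by (simp add: height_def real_vec_def sum_nonneg)
    ultimately have "real_vec w \<in> F" unfolding F_def by blast
    moreover have "w \<in> S" "w \<noteq> 0" using w G by auto
    ultimately obtain v t where v: "v \<in> extremal_generators S" "0 \<le> t" "x = t *\<^sub>R real_vec v"
      using extremal_generator_on_ray[OF F F_def cone_of_nonneg[OF xC(1)]] by blast
    then show ?thesis by (simp add: cone_of_eq_hull convex_cone_hull_mul hull_inc)
  qed
  have "K \<subseteq> cone_of (extremal_generators S)"
    by (subst KM, rule hull_minimal) (use ext cc in \<open>auto simp: convex_cone_def\<close>)
  show "y \<in> cone_of (extremal_generators S)"
  proof (cases "y = 0")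
    case True then show ?thesis using convex_cone_contains_0[OF cc] by simp
  next
    case False
    then have h: "0 < height y" using height_pos cone_of_nonneg[OF y] by blast
    then have "(1 / height y) *\<^sub>R y \<in> K"
      using convex_cone_scaleR[OF cc _ y, of "1 / height y"] by (simp add: K_def height_scaleR)
    then have "height y *\<^sub>R ((1 / height y) *\<^sub>R y) \<in> cone_of (extremal_generators S)"
      using \<open>K \<subseteq> _\<close> h convex_cone_scaleR[OF cc] by (meson less_imp_le subsetD)
    then show ?thesis using h by simp
  qed
qed

section \<open>Coordinates and degree\<close>

lemma nat_span_image:
  assumes "finite I" "inj_on a I"
  shows "nat_span (a ` I) = range (\<lambda>m. \<Sum>i\<in>I. m i *s a i)"
proof (intro equalityI subsetI)
  fix v assume "v \<in> nat_span (a ` I)"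
  then obtain F n where F: "v = (\<Sum>w\<in>F. n w *s w)" "finite F" "F \<subseteq> a ` I"
    unfolding nat_span_def by blast
  have "v = (\<Sum>w\<in>a ` I. (if w \<in> F then n w else 0) *s w)"
    unfolding F(1) by (rule sum.mono_neutral_cong_left) (use F assms in \<open>auto simp: vec_eq_iff\<close>)
  also have "\<dots> = (\<Sum>i\<in>I. (if a i \<in> F then n (a i) else 0) *s a i)"
    using assms(2) by (simp add: sum.reindex)
  finally show "v \<in> range (\<lambda>m. \<Sum>i\<in>I. m i *s a i)"
    by (rule image_eqI[of _ _ "\<lambda>i. if a i \<in> F then n (a i) else 0"]) simp
next
  fix v assume "v \<in> range (\<lambda>m. \<Sum>i\<in>I. m i *s a i)"
  then obtain m where m: "v = (\<Sum>i\<in>I. m i *s a i)" by blast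
  have "v = (\<Sum>w\<in>a ` I. m (the_inv_into I a w) *s w)"
    using assms(2) by (simp add: m sum.reindex the_inv_into_f_f)
  then show "v \<in> nat_span (a ` I)" unfolding nat_span_def using assms(1)
    by (intro CollectI exI[of _ "a ` I"] exI[of _ "\<lambda>w. m (the_inv_into I a w)"]) simp
qed

text \<open>
  All that the geometry contributes: the first \<open>d\<close> generators are linearly independent and
  their cone contains the semigroup. The rest of the argument is arithmetic with exponents.
\<close>
locale simplicial_generators =
  fixes S :: "(nat ^ 'd) set" and a :: "nat \<Rightarrow> nat ^ 'd" and s :: nat
  assumes nat_span_generators: "nat_span (a ` {1..CARD('d) + s}) = S"
    and inj_generators: "inj_on a {1..CARD('d) + s}"
    and independent_rays: "(\<Sum>i\<in>{1..CARD('d)}. c i *\<^sub>R real_vec (a i)) = 0 \<Longrightarrow> i \<in> {1..CARD('d)} \<Longrightarrow> c i = 0"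
    and cone_coords: "v \<in> S \<Longrightarrow> \<exists>c. (\<forall>i\<in>{1..CARD('d)}. 0 \<le> c i) \<and> real_vec v = (\<Sum>i\<in>{1..CARD('d)}. c i *\<^sub>R real_vec (a i))"
begin

lemma inj_rays: "inj_on a {1..CARD('d)}"
  using inj_on_subset[OF inj_generators, of "{1..CARD('d)}"] by simp

lemma real_coords_unique:
  assumes "(\<Sum>i\<in>{1..CARD('d)}. b i *\<^sub>R real_vec (a i)) = (\<Sum>i\<in>{1..CARD('d)}. c i *\<^sub>R real_vec (a i))"
    and "i \<in> {1..CARD('d)}"
  shows "b i = c i"
proof -
  have "(\<Sum>i\<in>{1..CARD('d)}. (b i - c i) *\<^sub>R real_vec (a i)) = 0"
    using assms(1) by (simp add: scaleR_left_diff_distrib sum_subtractf)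
  then show ?thesis using independent_rays[of "\<lambda>i. b i - c i"] assms(2) by simp
qed

definition ray_coords :: "nat ^ 'd \<Rightarrow> (nat \<Rightarrow> rat) \<Rightarrow> bool" where
  "ray_coords v l \<longleftrightarrow> (\<forall>i\<in>{1..CARD('d)}. 0 \<le> l i) \<and>
     (\<forall>k. of_nat (v $ k) = (\<Sum>i\<in>{1..CARD('d)}. l i * of_nat (a i $ k)))"

lemma real_vec_rat_sum:
  assumes "\<And>k. of_nat (v $ k) = (\<Sum>i\<in>{1..CARD('d)}. l i * of_nat (a i $ k) :: rat)"
  shows "real_vec v = (\<Sum>i\<in>{1..CARD('d)}. real_of_rat (l i) *\<^sub>R real_vec (a i))"
proof -
  have "real (v $ k) = (\<Sum>i\<in>{1..CARD('d)}. real_of_rat (l i) * real (a i $ k))" for k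
    using arg_cong[OF assms[of k], of real_of_rat] by (simp add: of_rat_sum of_rat_mult)
  then show ?thesis by (simp add: real_vec_def vec_eq_iff)
qed

lemma rat_coords_eqI:
  assumes "ray_coords v l"
  shows "rat_coords a v = restrict l {1..CARD('d)}"
  unfolding rat_coords_def
proof (rule the_equality, goal_cases)
  case 1
  then show ?case using assms by (auto simp: ray_coords_def intro!: sum.cong)
next
  case (2 m)
  show ?case
  proof (rule extensionalityI[of _ "{1..CARD('d)}"])
    show "m \<in> extensional {1..CARD('d)}" using 2 by (auto simp: PiE_def)
    fix i assume i: "i \<in> {1..CARD('d)}"
    have "real_of_rat (m i) = real_of_rat (l i)"
      using real_vec_rat_sum[of v m] real_vec_rat_sum[of v l] 2 assms
      by (intro real_coords_unique[of "\<lambda>i. real_of_rat (m i)" "\<lambda>i. real_of_rat (l i)" i] i)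
        (simp add: ray_coords_def)
    then show "m i = restrict l {1..CARD('d)} i" using i by simp
  qed simp
qed

lemma deg_eqI:
  assumes "ray_coords v l"
  shows "deg a v = (\<Sum>i\<in>{1..CARD('d)}. l i)"
  unfolding Defs.deg_def rat_coords_eqI[OF assms] by (intro sum.cong) simp_all

text \<open>
  Independence over the reals passes down to the rationals, and \<open>d\<close> independent vectors span
  the \<open>d\<close>-dimensional rational space, so rational coordinates exist. They agree with the real
  coordinates by uniqueness, hence are non-negative.
\<close>
lemma rat_coords_exist:
  assumes "v \<in> S"
  obtains l where "ray_coords v l"
proof -
  define q :: "nat ^ 'd \<Rightarrow> rat ^ 'd" where "q v = (\<chi> k. of_nat (v $ k))" for v
  have q_inj: "inj q" by (rule injI) (simp add: q_def vec_eq_iff)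
  have inj: "inj_on (\<lambda>i. q (a i)) {1..CARD('d)}"
    using inj_onD[OF inj_rays injD[OF q_inj]] by (intro inj_onI)
  have zero: "u (q (a i)) = 0"
    if u: "(\<Sum>w\<in>(\<lambda>i. q (a i)) ` {1..CARD('d)}. u w *s w) = 0" and i: "i \<in> {1..CARD('d)}" for u i
  proof -
    have "(\<Sum>j\<in>{1..CARD('d)}. u (q (a j)) *s q (a j)) = 0"
      using u sum.reindex[OF inj, of "\<lambda>w. u w *s w"] by simp
    then have "0 = (\<Sum>j\<in>{1..CARD('d)}. u (q (a j)) * of_nat (a j $ k))" for k
      by (simp add: q_def vec_eq_iff)
    then have "real_vec 0 = (\<Sum>j\<in>{1..CARD('d)}. real_of_rat (u (q (a j))) *\<^sub>R real_vec (a j))"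
      by (intro real_vec_rat_sum) simp
    then have "(\<Sum>j\<in>{1..CARD('d)}. real_of_rat (u (q (a j))) *\<^sub>R real_vec (a j)) = 0" by simp
    from independent_rays[OF this i] show ?thesis by simp
  qed
  have "vec.independent ((\<lambda>i. q (a i)) ` {1..CARD('d)})"
    unfolding vec.dependent_finite[OF finite_imageI[OF finite_atLeastAtMost]] using zero by blast
  moreover have "vec.dim (UNIV :: (rat ^ 'd) set) \<le> card ((\<lambda>i. q (a i)) ` {1..CARD('d)})"
    unfolding card_image[OF inj] vec_dim_card by simp
  ultimately have "q v \<in> vec.span ((\<lambda>i. q (a i)) ` {1..CARD('d)})"
    using vec.card_ge_dim_independent[of "(\<lambda>i. q (a i)) ` {1..CARD('d)}" UNIV] by blast
  then obtain u where "q v = (\<Sum>w\<in>(\<lambda>i. q (a i)) ` {1..CARD('d)}. u w *s w)"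
    by (auto simp: vec.span_finite)
  then have "q v = (\<Sum>j\<in>{1..CARD('d)}. u (q (a j)) *s q (a j))"
    using sum.reindex[OF inj, of "\<lambda>w. u w *s w"] by simp
  then have eq: "of_nat (v $ k) = (\<Sum>j\<in>{1..CARD('d)}. u (q (a j)) * of_nat (a j $ k))" for k
    by (simp add: q_def vec_eq_iff)
  obtain c where c: "\<forall>i\<in>{1..CARD('d)}. 0 \<le> c i" "real_vec v = (\<Sum>i\<in>{1..CARD('d)}. c i *\<^sub>R real_vec (a i))"
    using cone_coords[OF assms] by blast
  have "0 \<le> u (q (a i))" if i: "i \<in> {1..CARD('d)}" for i
  proof -
    have "real_of_rat (u (q (a i))) = c i"
      using real_vec_rat_sum[OF eq] c(2)
      by (intro real_coords_unique[of "\<lambda>i. real_of_rat (u (q (a i)))" c i] i) simp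
    then show ?thesis using c(1) i by (metis zero_le_of_rat_iff)
  qed
  then have "ray_coords v (\<lambda>i. u (q (a i)))" using eq by (simp add: ray_coords_def)
  then show thesis by (rule that)
qed

lemma deg_nonneg:
  assumes "v \<in> S"
  shows "0 \<le> deg a v"
proof -
  obtain l where l: "ray_coords v l" using rat_coords_exist[OF assms] .
  show ?thesis unfolding deg_eqI[OF l] using l by (intro sum_nonneg) (simp add: ray_coords_def)
qed

lemma deg_add:
  assumes "v \<in> S" "w \<in> S"
  shows "deg a (v + w) = deg a v + deg a w"
proof -
  obtain l m where lm: "ray_coords v l" "ray_coords w m"
    using rat_coords_exist[OF assms(1)] rat_coords_exist[OF assms(2)] by metis
  then have "ray_coords (v + w) (\<lambda>i. l i + m i)"
    by (simp add: ray_coords_def distrib_right sum.distrib)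
  from deg_eqI[OF this] deg_eqI[OF lm(1)] deg_eqI[OF lm(2)] show ?thesis by (simp add: sum.distrib)
qed

lemma deg_nat_combination: "deg a (\<Sum>i\<in>{1..CARD('d)}. m i *s a i) = of_nat (\<Sum>i\<in>{1..CARD('d)}. m i)"
proof -
  have "ray_coords (\<Sum>i\<in>{1..CARD('d)}. m i *s a i) (\<lambda>i. of_nat (m i))"
    by (simp add: ray_coords_def)
  from deg_eqI[OF this] show ?thesis by simp
qed

lemma zero_mem: "0 \<in> S"
  using nat_span_zero nat_span_generators by blast

lemma add_mem: "v \<in> S \<Longrightarrow> w \<in> S \<Longrightarrow> v + w \<in> S"
  using nat_span_add nat_span_generators by blast

lemma smult_mem: "v \<in> S \<Longrightarrow> n *s v \<in> S"
proof (induction n)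
  case 0 then show ?case using zero_mem by (simp add: vec_eq_iff vector_scalar_mult_def zero_vec_def)
next
  case (Suc n)
  have "Suc n *s v = v + n *s v" by (simp add: vec_eq_iff)
  then show ?case using Suc add_mem by simp
qed

lemma generator_mem: "i \<in> {1..CARD('d) + s} \<Longrightarrow> a i \<in> S"
  using nat_span_base nat_span_generators by blast

lemma deg_smult:
  assumes "v \<in> S"
  shows "deg a (n *s v) = of_nat n * deg a v"
proof (induction n)
  case 0
  have "0 *s v = (\<Sum>i\<in>{1..CARD('d)}. 0 *s a i)" by (simp add: vec_eq_iff)
  then show ?case by (simp only: deg_nat_combination) simp
next
  case (Suc n)
  have "Suc n *s v = v + n *s v" by (simp add: vec_eq_iff)
  then show ?case using Suc deg_add[OF assms smult_mem[OF assms, of n]] by (simp add: distrib_right)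
qed

lemma deg_ray: "i \<in> {1..CARD('d)} \<Longrightarrow> deg a (a i) = 1"
proof -
  assume i: "i \<in> {1..CARD('d)}"
  have "a i = (\<Sum>j\<in>{1..CARD('d)}. (if j = i then 1 else 0) *s a j)"
    using i by (simp add: vec_eq_iff if_distrib[of "\<lambda>x. x * _"] sum.delta cong: if_cong)
  then show ?thesis using deg_nat_combination[of "\<lambda>j. if j = i then 1 else 0"] i
    by (simp add: sum.delta)
qed

text \<open>
  Clearing the denominators of the rational coordinates; this makes the minimum that defines the
  numbers \<open>c\<^sub>j\<close> a minimum over a nonempty set.
\<close>
lemma multiple_in_ray_span:
  assumes "v \<in> S"
  shows "\<exists>c>0. c *s v \<in> nat_span (a ` {1..CARD('d)})"
proof -
  obtain l where "ray_coords v l" using rat_coords_exist[OF assms] .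
  then have l: "\<And>i. i \<in> {1..CARD('d)} \<Longrightarrow> 0 \<le> l i"
    "\<And>k. of_nat (v $ k) = (\<Sum>i\<in>{1..CARD('d)}. l i * of_nat (a i $ k))"
    by (simp_all add: ray_coords_def)
  define den where "den i = nat (snd (quotient_of (l i)))" for i
  define num where "num i = nat (fst (quotient_of (l i)))" for i
  have den: "0 < den i" for i using quotient_of_denom_pos'[of "l i"] by (simp add: den_def)
  have nd: "l i * of_nat (den i) = of_nat (num i)" if i: "i \<in> {1..CARD('d)}" for i
  proof -
    obtain p q where pq: "quotient_of (l i) = (p, q)" by fastforce
    then have "q > 0" "l i = of_int p / of_int q" using quotient_of_denom_pos quotient_of_div by auto
    then show ?thesis using l(1)[OF i] pq
      by (simp add: den_def num_def zero_le_divide_iff)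
  qed
  define c where "c = prod den {1..CARD('d)}"
  define m where "m i = num i * prod den ({1..CARD('d)} - {i})" for i
  have "of_nat c * l i = of_nat (m i)" if i: "i \<in> {1..CARD('d)}" for i
    using nd[OF i] prod.remove[OF _ i, of den] by (simp add: c_def m_def) (simp add: algebra_simps)
  then have "of_nat c * of_nat (v $ k) = (\<Sum>i\<in>{1..CARD('d)}. of_nat (m i) * of_nat (a i $ k) :: rat)" for k
    unfolding l(2) sum_distrib_left by (intro sum.cong) (simp_all add: mult.assoc[symmetric])
  then have "c * v $ k = (\<Sum>i\<in>{1..CARD('d)}. m i * a i $ k)" for k
    by (metis (mono_tags, lifting) of_nat_eq_iff of_nat_mult of_nat_sum sum.cong)
  then have "c *s v = (\<Sum>i\<in>{1..CARD('d)}. m i *s a i)" by (simp add: vec_eq_iff)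
  moreover have "0 < c" using den by (simp add: c_def)
  ultimately show ?thesis unfolding nat_span_image[OF finite_atLeastAtMost inj_rays] by blast
qed

lemma nat_coords_eq:
  assumes "v = (\<Sum>i\<in>{1..CARD('d)}. m i *s a i)"
  shows "nat_coords a v = restrict m {1..CARD('d)}"
  unfolding nat_coords_def
proof (rule the_equality, goal_cases)
  case 1
  then show ?case using assms by (auto intro!: sum.cong)
next
  case (2 l)
  show ?case
  proof (rule extensionalityI[of _ "{1..CARD('d)}"])
    show "l \<in> extensional {1..CARD('d)}" using 2 by (auto simp: PiE_def)
    fix i assume i: "i \<in> {1..CARD('d)}"
    have rv: "real_vec (\<Sum>i\<in>{1..CARD('d)}. n i *s a i) = (\<Sum>i\<in>{1..CARD('d)}. real (n i) *\<^sub>R real_vec (a i))" for n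
      by (simp add: real_vec_def vec_eq_iff)
    have "real (l i) = real (m i)"
      using 2 assms rv[of l] rv[of m]
      by (intro real_coords_unique[of "\<lambda>i. real (l i)" "\<lambda>i. real (m i)" i] i) simp
    then show "l i = restrict m {1..CARD('d)} i" using i by simp
  qed simp
qed

lemma c_num_relation:
  assumes j: "j \<in> {1..s}"
  obtains l where "0 < c_num a j"
    "c_num a j *s a (CARD('d) + j) = (\<Sum>i\<in>{1..CARD('d)}. l i *s a i)"
    "e_num a j = (\<Sum>i\<in>{1..CARD('d)}. l i)"
proof -
  have "a (CARD('d) + j) \<in> S" using j by (intro generator_mem) auto
  then have "\<exists>c. 0 < c \<and> c *s a (CARD('d) + j) \<in> nat_span (a ` {1..CARD('d)})"
    using multiple_in_ray_span by blast
  then have c: "0 < c_num a j \<and> c_num a j *s a (CARD('d) + j) \<in> nat_span (a ` {1..CARD('d)})"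
    unfolding c_num_def by (rule LeastI_ex)
  then obtain l where l: "c_num a j *s a (CARD('d) + j) = (\<Sum>i\<in>{1..CARD('d)}. l i *s a i)"
    unfolding nat_span_image[OF finite_atLeastAtMost inj_rays] by blast
  have "e_num a j = (\<Sum>i\<in>{1..CARD('d)}. l i)" unfolding e_num_def nat_coords_eq[OF l] by simp
  with c l show thesis using that by blast
qed

lemma e_num_eq_deg:
  assumes j: "j \<in> {1..s}"
  shows "of_nat (e_num a j) = of_nat (c_num a j) * deg a (a (CARD('d) + j))"
proof -
  obtain l where l: "0 < c_num a j"
    "c_num a j *s a (CARD('d) + j) = (\<Sum>i\<in>{1..CARD('d)}. l i *s a i)"
    "e_num a j = (\<Sum>i\<in>{1..CARD('d)}. l i)" using c_num_relation[OF j] by blast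
  have "a (CARD('d) + j) \<in> S" using j by (intro generator_mem) auto
  from deg_smult[OF this, of "c_num a j"] show ?thesis
    unfolding l(2) l(3) deg_nat_combination by simp
qed

text \<open>
  The first bound is \<open>e\<^sub>j = c\<^sub>j deg a\<^sub>d\<^sub>+\<^sub>j\<close>. If \<open>e\<^sub>j\<close> were \<open>1\<close>, then so would be
  \<open>c\<^sub>j\<close>, and \<open>a\<^sub>d\<^sub>+\<^sub>j\<close> would equal one of the first \<open>d\<close> generators. The second bound
  serves to make \<open>s l - 1\<close> positive, as an upper bound for a reduction number must be.
\<close>
lemma e_num_bounds:
  assumes j: "j \<in> {1..s}" and deg: "1 \<le> deg a (a (CARD('d) + j))"
  shows "c_num a j \<le> e_num a j" and "2 \<le> e_num a j"
proof -
  obtain l where l: "0 < c_num a j"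
    "c_num a j *s a (CARD('d) + j) = (\<Sum>i\<in>{1..CARD('d)}. l i *s a i)"
    "e_num a j = (\<Sum>i\<in>{1..CARD('d)}. l i)" using c_num_relation[OF j] by blast
  have "of_nat (c_num a j) * 1 \<le> of_nat (c_num a j) * deg a (a (CARD('d) + j))"
    using deg by (intro mult_left_mono) auto
  then have "of_nat (c_num a j) \<le> (of_nat (e_num a j) :: rat)" using e_num_eq_deg[OF j] by simp
  then show ce: "c_num a j \<le> e_num a j" by simp
  show "2 \<le> e_num a j"
  proof (rule ccontr)
    assume "\<not> 2 \<le> e_num a j"
    then have e1: "e_num a j = 1" "c_num a j = 1" using ce l(1) by auto
    then have "(\<Sum>i\<in>{1..CARD('d)}. l i) = 1" using l(3) by simp
    then obtain i where i: "i \<in> {1..CARD('d)}" "l i = 1" "\<forall>k\<in>{1..CARD('d)}. i \<noteq> k \<longrightarrow> l k = 0"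
      using sum_eq_1_iff[of "{1..CARD('d)}" l] by auto
    have "a (CARD('d) + j) = (\<Sum>k\<in>{1..CARD('d)}. l k *s a k)" using l(2) e1 by (simp add: vec_eq_iff)
    also have "\<dots> = l i *s a i + (\<Sum>k\<in>{1..CARD('d)} - {i}. l k *s a k)"
      using i(1) by (simp add: sum.remove)
    also have "(\<Sum>k\<in>{1..CARD('d)} - {i}. l k *s a k) = 0"
      using i(3) by (intro sum.neutral) (auto simp: vec_eq_iff)
    finally have "a (CARD('d) + j) = a i" using i(2) by (simp add: vec_eq_iff)
    then have "CARD('d) + j = i" using inj_generators i(1) j by (auto dest: inj_onD)
    then show False using i(1) j by simp
  qed
qed

end

section \<open>Ideals spanned by monomials\<close>

definition supported_in :: "(nat ^ 'd) set \<Rightarrow> ((nat ^ 'd) \<Rightarrow>\<^sub>0 'k::field) set" where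
  "supported_in T = {f. Poly_Mapping.keys f \<subseteq> T}"

lemma semigroup_ring_simps [simp]:
  "carrier (semigroup_ring S) = supported_in S"
  "mult (semigroup_ring S) = (*)" "add (semigroup_ring S) = (+)"
  "one (semigroup_ring S) = 1" "zero (semigroup_ring S) = 0"
  by (simp_all add: semigroup_ring_def poly_ring_def supported_in_def)

lemma zero_supported [simp]: "0 \<in> supported_in T"
  by (simp add: supported_in_def)

lemma single_supported: "v \<in> T \<Longrightarrow> Poly_Mapping.single v c \<in> supported_in T"
  by (simp add: supported_in_def)

lemma monomial_supported_iff: "monomial v \<in> (supported_in T :: ((nat ^ 'd) \<Rightarrow>\<^sub>0 'k::field) set) \<longleftrightarrow> v \<in> T"
  by (simp add: supported_in_def monomial_def)

lemma supported_add: "f \<in> supported_in T \<Longrightarrow> g \<in> supported_in T \<Longrightarrow> f + g \<in> supported_in T"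
  using Poly_Mapping.keys_add[of f g] by (auto simp: supported_in_def)

lemma supported_uminus: "f \<in> supported_in T \<Longrightarrow> - f \<in> supported_in T"
  by (simp add: supported_in_def)

lemma supported_mult: "f \<in> supported_in T \<Longrightarrow> g \<in> supported_in U \<Longrightarrow> f * g \<in> supported_in (T + U)"
  using keys_mult[of f g] unfolding supported_in_def set_plus_def by fast

lemma supported_in_mono: "T \<subseteq> U \<Longrightarrow> supported_in T \<subseteq> supported_in U"
  by (auto simp: supported_in_def)

lemma supported_in_eq_iff:
  "(supported_in T :: ((nat ^ 'd) \<Rightarrow>\<^sub>0 'k::field) set) = supported_in U \<longleftrightarrow> T = U"
proof
  assume eq: "(supported_in T :: ((nat ^ 'd) \<Rightarrow>\<^sub>0 'k) set) = supported_in U"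
  have "v \<in> T \<longleftrightarrow> v \<in> U" for v
    using monomial_supported_iff[of v T, where 'k = 'k] monomial_supported_iff[of v U, where 'k = 'k]
    unfolding eq by simp
  then show "T = U" by blast
qed simp

text \<open>
  Every polynomial is a sum of terms; inclusions between spans of monomials are therefore checked on
  single terms.
\<close>
lemma supported_induct [consumes 1, case_names zero add single]:
  assumes f: "f \<in> supported_in T"
    and zero: "P 0" and add: "\<And>f g. P f \<Longrightarrow> P g \<Longrightarrow> P (f + g)"
    and single: "\<And>v c. v \<in> T \<Longrightarrow> P (Poly_Mapping.single v c)"
  shows "P f"
proof -
  have sums: "P (\<Sum>v\<in>F. Poly_Mapping.single v (Poly_Mapping.lookup f v))" if "finite F" "F \<subseteq> T" for F
    using that by (induction F) (auto simp: zero intro!: add single)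
  have "f = (\<Sum>v\<in>Poly_Mapping.keys f. Poly_Mapping.single v (Poly_Mapping.lookup f v))"
    by (rule poly_mapping_eqI) (simp add: lookup_sum lookup_single when_def in_keys_iff)
  moreover have "P (\<Sum>v\<in>Poly_Mapping.keys f. Poly_Mapping.single v (Poly_Mapping.lookup f v))"
    using f by (intro sums finite_keys) (simp add: supported_in_def)
  ultimately show ?thesis by (simp only:)
qed

text \<open>
  Sums of exponent sets describe products of ideals. With \<open>supported_in_eq_iff\<close> this turns every
  identity between the ideals in question into an identity between sets of exponents.
\<close>
lemma ideal_prod_supported:
  "supported_in T \<cdot>\<^bsub>semigroup_ring S\<^esub> supported_in U = (supported_in (T + U) :: ((nat ^ 'd) \<Rightarrow>\<^sub>0 'k::field) set)"
    (is "?P = _")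
proof (intro equalityI subsetI)
  fix f :: "(nat ^ 'd) \<Rightarrow>\<^sub>0 'k" assume "f \<in> ?P"
  then show "f \<in> supported_in (T + U)"
    by induction (auto intro: supported_mult supported_add)
next
  have times: "g * h \<in> ?P" if "g \<in> supported_in T" "h \<in> supported_in U" for g h :: "(nat ^ 'd) \<Rightarrow>\<^sub>0 'k"
    using ideal_prod.prod[OF that, of "semigroup_ring S"] by simp
  have plus: "g + h \<in> ?P" if "g \<in> ?P" "h \<in> ?P" for g h :: "(nat ^ 'd) \<Rightarrow>\<^sub>0 'k"
    using ideal_prod.sum[OF that] by simp
  fix f :: "(nat ^ 'd) \<Rightarrow>\<^sub>0 'k" assume "f \<in> supported_in (T + U)"
  then show "f \<in> ?P"
  proof (induction rule: supported_induct)
    case zero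
    show ?case using times[of 0 0] by simp
  next
    case (add f g)
    then show ?case by (rule plus)
  next
    case (single v c)
    then obtain t u where "v = t + u" "t \<in> T" "u \<in> U" by (rule set_plus_elim)
    then show ?case
      using times[of "Poly_Mapping.single t c" "Poly_Mapping.single u 1"]
      by (simp add: single_supported mult_single)
  qed
qed

lemma cring_semigroup_ring:
  assumes "0 \<in> S" "S + S \<subseteq> S"
  shows "cring (semigroup_ring S :: ((nat ^ 'd) \<Rightarrow>\<^sub>0 'k::field) ring)"
proof (rule cringI)
  have one: "(1 :: (nat ^ 'd) \<Rightarrow>\<^sub>0 'k) \<in> supported_in S"
    using single_supported[OF assms(1), of 1] by simp
  have mult: "f * g \<in> supported_in S" if "f \<in> supported_in S" "g \<in> supported_in S" for f g :: "(nat ^ 'd) \<Rightarrow>\<^sub>0 'k"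
    using supported_mult[OF that] supported_in_mono[OF assms(2)] by blast
  show "abelian_group (semigroup_ring S :: ((nat ^ 'd) \<Rightarrow>\<^sub>0 'k) ring)"
  proof (rule abelian_groupI)
    fix x :: "(nat ^ 'd) \<Rightarrow>\<^sub>0 'k" assume "x \<in> carrier (semigroup_ring S)"
    then show "\<exists>y\<in>carrier (semigroup_ring S). y \<oplus>\<^bsub>semigroup_ring S\<^esub> x = \<zero>\<^bsub>semigroup_ring S\<^esub>"
      by (intro bexI[of _ "- x"]) (simp_all add: supported_uminus)
  qed (simp_all add: ac_simps supported_add)
  show "comm_monoid (semigroup_ring S :: ((nat ^ 'd) \<Rightarrow>\<^sub>0 'k) ring)"
    by (rule comm_monoidI) (simp_all add: ac_simps mult one)
qed (simp add: distrib_right)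

lemma ideal_supported:
  assumes S: "0 \<in> S" "S + S \<subseteq> S" and T: "T \<subseteq> S" "T + S \<subseteq> T"
  shows "ideal (supported_in T) (semigroup_ring S :: ((nat ^ 'd) \<Rightarrow>\<^sub>0 'k::field) ring)"
proof -
  interpret cring "semigroup_ring S :: ((nat ^ 'd) \<Rightarrow>\<^sub>0 'k::field) ring"
    by (rule cring_semigroup_ring[OF S])
  have minus: "\<ominus>\<^bsub>semigroup_ring S\<^esub> f = - f" if "f \<in> supported_in S" for f :: "(nat ^ 'd) \<Rightarrow>\<^sub>0 'k"
    by (rule minus_equality) (simp_all add: that supported_uminus)
  have sub: "f \<in> supported_in S" if "f \<in> supported_in T" for f :: "(nat ^ 'd) \<Rightarrow>\<^sub>0 'k"
    using supported_in_mono[OF T(1)] that by blast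
  have mult: "f * g \<in> supported_in T" if "f \<in> supported_in T" "g \<in> supported_in S"
    for f g :: "(nat ^ 'd) \<Rightarrow>\<^sub>0 'k"
    using supported_mult[OF that] supported_in_mono[OF T(2)] by blast
  show ?thesis
  proof (rule idealI)
    show "subgroup (supported_in T) (add_monoid (semigroup_ring S :: ((nat ^ 'd) \<Rightarrow>\<^sub>0 'k) ring))"
    proof (rule add.subgroupI)
      fix f :: "(nat ^ 'd) \<Rightarrow>\<^sub>0 'k" assume "f \<in> supported_in T"
      then show "\<ominus>\<^bsub>semigroup_ring S\<^esub> f \<in> supported_in T"
        using minus[OF sub] by (simp add: supported_uminus)
    qed (auto simp: supported_add sub intro: zero_supported)
  qed (simp_all add: mult mult.commute ring_axioms)
qed

lemma genideal_monomials:
  assumes S: "0 \<in> S" "S + S \<subseteq> S" and B: "B \<subseteq> S"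
  shows "Idl\<^bsub>semigroup_ring S\<^esub> (monomial ` B) = (supported_in (B + S) :: ((nat ^ 'd) \<Rightarrow>\<^sub>0 'k::field) set)"
    (is "?I = _")
proof
  interpret cring "semigroup_ring S :: ((nat ^ 'd) \<Rightarrow>\<^sub>0 'k::field) ring"
    by (rule cring_semigroup_ring[OF S])
  have sub: "monomial ` B \<subseteq> carrier (semigroup_ring S :: ((nat ^ 'd) \<Rightarrow>\<^sub>0 'k) ring)"
    using B by (auto simp: monomial_supported_iff)
  have "B + S \<subseteq> S" using B S(2) set_plus_mono2[of B S S S] by blast
  moreover have "B + S + S \<subseteq> B + S"
    unfolding add.assoc using S(2) by (intro set_plus_mono2) auto
  ultimately have "ideal (supported_in (B + S)) (semigroup_ring S :: ((nat ^ 'd) \<Rightarrow>\<^sub>0 'k) ring)"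
    by (rule ideal_supported[OF S])
  moreover have "monomial ` B \<subseteq> (supported_in (B + S) :: ((nat ^ 'd) \<Rightarrow>\<^sub>0 'k) set)"
    using set_plus_intro[OF _ S(1), of _ B] by (auto simp: monomial_supported_iff)
  ultimately show "?I \<subseteq> supported_in (B + S)" by (rule genideal_minimal)
  interpret I: ideal ?I "semigroup_ring S :: ((nat ^ 'd) \<Rightarrow>\<^sub>0 'k) ring" by (rule genideal_ideal[OF sub])
  show "supported_in (B + S) \<subseteq> ?I"
  proof
    fix f :: "(nat ^ 'd) \<Rightarrow>\<^sub>0 'k" assume "f \<in> supported_in (B + S)"
    then show "f \<in> ?I"
    proof (induction rule: supported_induct)
      case zero
      show ?case using I.zero_closed by simp
    next
      case (add f g)
      then show ?case using I.a_closed[of f g] by simp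
    next
      case (single v c)
      then obtain b u where v: "v = b + u" "b \<in> B" "u \<in> S" by (rule set_plus_elim)
      have "monomial b \<in> ?I" using genideal_self[OF sub] v(2) by blast
      then have "monomial b * Poly_Mapping.single u c \<in> ?I"
        using I.I_r_closed[of "monomial b" "Poly_Mapping.single u c"] v(3) by (simp add: single_supported)
      then show ?case by (simp add: monomial_def mult_single v(1))
    qed
  qed
qed

section \<open>Powers of the maximal ideal as sums of many generators\<close>

context simplicial_generators
begin

text \<open>
  The exponents of the monomials in the \<open>n\<close>-th power of the maximal ideal, see
  \<open>power_maximal_ideal\<close> below.
\<close>
definition long_sums :: "nat \<Rightarrow> (nat ^ 'd) set" where
  "long_sums n = {(\<Sum>i\<in>{1..CARD('d) + s}. m i *s a i) | m. n \<le> (\<Sum>i\<in>{1..CARD('d) + s}. m i)}"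

lemma mem_S_iff: "v \<in> S \<longleftrightarrow> (\<exists>m. v = (\<Sum>i\<in>{1..CARD('d) + s}. m i *s a i))"
  using nat_span_image[OF finite_atLeastAtMost inj_generators] nat_span_generators by auto

lemma long_sums_0: "long_sums 0 = S"
  unfolding long_sums_def using mem_S_iff by auto

lemma long_sums_subset: "long_sums n \<subseteq> S"
  unfolding long_sums_def using mem_S_iff by auto

text \<open>
  For \<open>J\<close> all indices this describes passing from one power of the maximal ideal to the next, for
  \<open>J\<close> the first \<open>d\<close> indices it describes multiplication by the ideal of the extremal
  rays. The two differ only in which generators must occur in the sum.
\<close>
lemma generators_add_long_sums:
  assumes J: "J \<subseteq> {1..CARD('d) + s}"
  shows "(a ` J + S) + long_sums n =
    {(\<Sum>i\<in>{1..CARD('d) + s}. m i *s a i) | m.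
       Suc n \<le> (\<Sum>i\<in>{1..CARD('d) + s}. m i) \<and> (\<exists>j\<in>J. 0 < m j)}" (is "?L = ?R")
proof (intro equalityI subsetI)
  fix v assume "v \<in> ?L"
  then obtain x w where xw: "v = x + w" "x \<in> a ` J + S" "w \<in> long_sums n" by (rule set_plus_elim)
  from xw(2) obtain y t where yt: "x = y + t" "y \<in> a ` J" "t \<in> S" by (rule set_plus_elim)
  from yt(2) obtain j where j: "y = a j" "j \<in> J" by (rule imageE)
  obtain p where p: "t = (\<Sum>i\<in>{1..CARD('d) + s}. p i *s a i)" using yt(3) mem_S_iff by blast
  obtain m where m: "w = (\<Sum>i\<in>{1..CARD('d) + s}. m i *s a i)" "n \<le> (\<Sum>i\<in>{1..CARD('d) + s}. m i)"
    using xw(3) unfolding long_sums_def by blast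
  define q where "q i = (if i = j then 1 else 0) + p i + m i" for i
  have jI: "j \<in> {1..CARD('d) + s}" using j J by blast
  have delta: "(\<Sum>i\<in>{1..CARD('d) + s}. (if i = j then 1 else 0) * g i) = (g j :: nat)" for g
    using jI by (simp add: if_distrib[of "\<lambda>x. x * _"] cong: if_cong)
  have "v = (\<Sum>i\<in>{1..CARD('d) + s}. q i *s a i)"
    unfolding xw(1) yt(1) j(1) p m(1) using delta
    by (simp add: q_def vec_eq_iff distrib_right sum.distrib)
  moreover have "Suc n \<le> (\<Sum>i\<in>{1..CARD('d) + s}. q i)"
    using m(2) delta[of "\<lambda>_. 1"] by (simp add: q_def sum.distrib)
  moreover have "0 < q j" by (simp add: q_def)
  ultimately show "v \<in> ?R" using j(2) by blast
next
  fix v assume "v \<in> ?R"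
  then obtain q j where q: "v = (\<Sum>i\<in>{1..CARD('d) + s}. q i *s a i)"
    "Suc n \<le> (\<Sum>i\<in>{1..CARD('d) + s}. q i)" "j \<in> J" "0 < q j" by blast
  have jI: "j \<in> {1..CARD('d) + s}" using q(3) J by blast
  define m where "m = q(j := q j - 1)"
  have rest: "(\<Sum>i\<in>{1..CARD('d) + s} - {j}. q i * g i) = (\<Sum>i\<in>{1..CARD('d) + s} - {j}. m i * g i)"
    for g :: "nat \<Rightarrow> nat" by (intro sum.cong) (auto simp: m_def)
  have remove: "(\<Sum>i\<in>{1..CARD('d) + s}. q i * g i) = g j + (\<Sum>i\<in>{1..CARD('d) + s}. m i * g i)"
    for g :: "nat \<Rightarrow> nat"
  proof -
    have "q j * g j = g j + m j * g j" using q(4) by (cases "q j") (simp_all add: m_def)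
    then show ?thesis
      using sum.remove[OF finite_atLeastAtMost jI, of "\<lambda>i. q i * g i"]
        sum.remove[OF finite_atLeastAtMost jI, of "\<lambda>i. m i * g i"] rest[of g] by simp
  qed
  have "v = (a j + 0) + (\<Sum>i\<in>{1..CARD('d) + s}. m i *s a i)"
    unfolding q(1) using remove by (simp add: vec_eq_iff)
  moreover have "n \<le> (\<Sum>i\<in>{1..CARD('d) + s}. m i)" using q(2) remove[of "\<lambda>_. 1"] by simp
  then have "(\<Sum>i\<in>{1..CARD('d) + s}. m i *s a i) \<in> long_sums n"
    unfolding long_sums_def by blast
  ultimately show "v \<in> ?L" using q(3) zero_mem by (simp only:) (intro set_plus_intro imageI)
qed

lemma long_sums_Suc: "long_sums (Suc n) = (a ` {1..CARD('d) + s} + S) + long_sums n"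
  unfolding generators_add_long_sums[OF order_refl] unfolding long_sums_def
proof (intro Collect_cong ex_cong1 conj_cong refl iffI)
  fix m assume "Suc n \<le> (\<Sum>i\<in>{1..CARD('d) + s}. m i)"
  then have "(\<Sum>i\<in>{1..CARD('d) + s}. m i) \<noteq> 0" by linarith
  then show "Suc n \<le> (\<Sum>i\<in>{1..CARD('d) + s}. m i) \<and> (\<exists>j\<in>{1..CARD('d) + s}. 0 < m j)"
    using \<open>Suc n \<le> _\<close> sum.neutral[of "{1..CARD('d) + s}" m] neq0_conv by metis
qed simp

lemma S_submonoid: "0 \<in> S" "S + S \<subseteq> S"
  using zero_mem add_mem by (auto elim!: set_plus_elim)

lemma genideal_generators:
  assumes "J \<subseteq> {1..CARD('d) + s}"
  shows "Idl\<^bsub>semigroup_ring S\<^esub> (monomial ` a ` J) = (supported_in (a ` J + S) :: ((nat ^ 'd) \<Rightarrow>\<^sub>0 'k::field) set)"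
  using assms generator_mem by (intro genideal_monomials S_submonoid) auto

lemma power_maximal_ideal:
  "(Idl\<^bsub>semigroup_ring S\<^esub> (monomial ` a ` {1..CARD('d) + s})) [^]\<^bsub>ideals_set (semigroup_ring S)\<^esub> n =
     (supported_in (long_sums n) :: ((nat ^ 'd) \<Rightarrow>\<^sub>0 'k::field) set)"
proof (induction n)
  case 0
  show ?case by (simp add: nat_pow_def ideals_set_def long_sums_0)
next
  case (Suc n)
  then show ?case
    by (simp add: nat_pow_def ideals_set_def genideal_generators ideal_prod_supported long_sums_Suc add.commute)
qed

text \<open>
  The reduction property is a statement about exponents only: a sum of at least \<open>n + 1\<close>
  generators can be rewritten as such a sum in which one of the extremal rays occurs.
\<close>
lemma reduction_step_iff:
  fixes R :: "((nat ^ 'd) \<Rightarrow>\<^sub>0 'k::field) ring"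
  defines "R \<equiv> semigroup_ring S"
  defines "M \<equiv> Idl\<^bsub>R\<^esub> (monomial ` a ` {1..CARD('d) + s})"
  defines "I \<equiv> Idl\<^bsub>R\<^esub> (monomial ` a ` {1..CARD('d)})"
  shows "M [^]\<^bsub>ideals_set R\<^esub> (n + 1) = I \<cdot>\<^bsub>R\<^esub> (M [^]\<^bsub>ideals_set R\<^esub> n) \<longleftrightarrow>
    long_sums (Suc n) = (a ` {1..CARD('d)} + S) + long_sums n"
proof -
  have "{1..CARD('d)} \<subseteq> {1..CARD('d) + s}" by auto
  then have "I = supported_in (a ` {1..CARD('d)} + S)"
    unfolding I_def R_def by (rule genideal_generators)
  then show ?thesis
    unfolding M_def R_def power_maximal_ideal by (simp add: ideal_prod_supported supported_in_eq_iff)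
qed

section \<open>Degree and reduction\<close>

text \<open>
  Each reduction step splits off an extremal ray, which contributes degree \<open>1\<close>.
\<close>
lemma deg_ge_of_long_sum:
  assumes red: "\<And>n. n0 \<le> n \<Longrightarrow> long_sums (Suc n) = (a ` {1..CARD('d)} + S) + long_sums n"
    and v: "v \<in> long_sums (n0 + k)"
  shows "of_nat k \<le> deg a v"
  using v
proof (induction k arbitrary: v)
  case 0
  then show ?case using long_sums_subset deg_nonneg by auto
next
  case (Suc k)
  then have "v \<in> (a ` {1..CARD('d)} + S) + long_sums (n0 + k)" using red[of "n0 + k"] by simp
  then obtain x w where xw: "v = x + w" "x \<in> a ` {1..CARD('d)} + S" "w \<in> long_sums (n0 + k)"
    by (rule set_plus_elim)
  from xw(2) obtain y t where yt: "x = y + t" "y \<in> a ` {1..CARD('d)}" "t \<in> S" by (rule set_plus_elim)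
  from yt(2) obtain i where i: "y = a i" "i \<in> {1..CARD('d)}" by (rule imageE)
  have aS: "a i \<in> S" using i(2) by (intro generator_mem) auto
  have wS: "w \<in> S" using xw(3) long_sums_subset by blast
  have "deg a v = 1 + deg a t + deg a w"
    unfolding xw(1) yt(1) i(1) deg_add[OF add_mem[OF aS yt(3)] wS] deg_add[OF aS yt(3)] deg_ray[OF i(2)] ..
  then show ?case using Suc.IH[OF xw(3)] deg_nonneg[OF yt(3)] by simp
qed

text \<open>
  The multiple \<open>(n\<^sub>0 + k) a\<^sub>i\<close> is a sum of \<open>n\<^sub>0 + k\<close> generators, so its degree is at least
  \<open>k\<close>. As \<open>k\<close> grows, this excludes \<open>deg a\<^sub>i < 1\<close>.
\<close>
lemma deg_ge_1_of_reduction: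
  assumes red: "\<And>n. n0 \<le> n \<Longrightarrow> long_sums (Suc n) = (a ` {1..CARD('d)} + S) + long_sums n"
    and i: "i \<in> {1..CARD('d) + s}"
  shows "1 \<le> deg a (a i)"
proof (rule ccontr)
  assume "\<not> 1 \<le> deg a (a i)"
  then have pos: "0 < 1 - deg a (a i)" by simp
  have bound: "of_nat k \<le> of_nat (n0 + k) * deg a (a i)" for k
  proof -
    have delta: "(\<Sum>j\<in>{1..CARD('d) + s}. (if j = i then n0 + k else 0) * g j) = (n0 + k) * g i"
      for g :: "nat \<Rightarrow> nat"
      using i by (simp add: if_distrib[of "\<lambda>x. x * _"] cong: if_cong)
    have "(n0 + k) *s a i = (\<Sum>j\<in>{1..CARD('d) + s}. (if j = i then n0 + k else 0) *s a j)"
      using delta by (simp add: vec_eq_iff distrib_right)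
    moreover have "n0 + k \<le> (\<Sum>j\<in>{1..CARD('d) + s}. if j = i then n0 + k else 0)"
      using delta[of "\<lambda>_. 1"] by simp
    ultimately have "(n0 + k) *s a i \<in> long_sums (n0 + k)"
      unfolding long_sums_def by (intro CollectI exI[of _ "\<lambda>j. if j = i then n0 + k else 0"]) simp
    from deg_ge_of_long_sum[OF red this] show ?thesis
      unfolding deg_smult[OF generator_mem[OF i]] .
  qed
  obtain k where k: "of_nat n0 < of_nat k * (1 - deg a (a i))"
    using ex_less_of_nat_mult[OF pos] by blast
  have "of_nat k * (1 - deg a (a i)) \<le> of_nat n0 * deg a (a i)"
    using bound[of k] by (simp add: algebra_simps)
  also have "\<dots> \<le> of_nat n0" using pos by (intro mult_left_le) auto
  finally show False using k by simp
qed

text \<open>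
  In a sum of more than \<open>s (l - 1)\<close> generators without extremal rays, the pigeonhole principle
  gives a generator \<open>a\<^sub>d\<^sub>+\<^sub>j\<close> that occurs at least \<open>l \<ge> e\<^sub>j \<ge> c\<^sub>j\<close> times. Replacing
  \<open>c\<^sub>j\<close> copies of it by the \<open>e\<^sub>j\<close> extremal rays of its defining relation brings in an
  extremal ray and does not shorten the sum.
\<close>
lemma reduction_step_of_deg_ge_1:
  assumes deg: "\<And>j. j \<in> {1..s} \<Longrightarrow> 1 \<le> deg a (a (CARD('d) + j))"
    and e: "\<And>j. j \<in> {1..s} \<Longrightarrow> e_num a j \<le> l" and n: "s * (l - 1) \<le> n"
  shows "long_sums (Suc n) = (a ` {1..CARD('d)} + S) + long_sums n"
proof (rule antisym)
  show "(a ` {1..CARD('d)} + S) + long_sums n \<subseteq> long_sums (Suc n)"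
    unfolding long_sums_Suc by (intro set_plus_mono2 image_mono order_refl) auto
  have sub: "{1..CARD('d)} \<subseteq> {1..CARD('d) + s}" by auto
  show "long_sums (Suc n) \<subseteq> (a ` {1..CARD('d)} + S) + long_sums n"
  proof
    fix v assume "v \<in> long_sums (Suc n)"
    then obtain m where m: "v = (\<Sum>i\<in>{1..CARD('d) + s}. m i *s a i)"
      "Suc n \<le> (\<Sum>i\<in>{1..CARD('d) + s}. m i)" unfolding long_sums_def by blast
    show "v \<in> (a ` {1..CARD('d)} + S) + long_sums n"
    proof (cases "\<exists>i\<in>{1..CARD('d)}. 0 < m i")
      case True
      then show ?thesis unfolding generators_add_long_sums[OF sub] using m by blast
    next
      case False
      have "(\<Sum>i\<in>{1..CARD('d) + s}. m i) = (\<Sum>i\<in>{1..CARD('d)}. m i) + (\<Sum>i\<in>{CARD('d) + 1..CARD('d) + s}. m i)"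
        by (rule sum.ub_add_nat) simp
      also have "(\<Sum>i\<in>{1..CARD('d)}. m i) = 0" using False by (intro sum.neutral) auto
      also have "(\<Sum>i\<in>{CARD('d) + 1..CARD('d) + s}. m i) = (\<Sum>j\<in>{1..s}. m (CARD('d) + j))"
        using sum.shift_bounds_cl_nat_ivl[of m 1 "CARD('d)" s] by (simp add: add.commute)
      finally have sum_m: "Suc n \<le> (\<Sum>j\<in>{1..s}. m (CARD('d) + j))" using m(2) by simp
      have "\<exists>j\<in>{1..s}. l \<le> m (CARD('d) + j)"
      proof (rule ccontr)
        assume "\<not> (\<exists>j\<in>{1..s}. l \<le> m (CARD('d) + j))"
        then have "(\<Sum>j\<in>{1..s}. m (CARD('d) + j)) \<le> (\<Sum>j\<in>{1..s}. l - 1)"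
          by (intro sum_mono) force
        then show False using sum_m n by simp
      qed
      then obtain j where j: "j \<in> {1..s}" "l \<le> m (CARD('d) + j)" by blast
      define c where "c = c_num a j"
      obtain r where r: "0 < c" "c *s a (CARD('d) + j) = (\<Sum>i\<in>{1..CARD('d)}. r i *s a i)"
        "e_num a j = (\<Sum>i\<in>{1..CARD('d)}. r i)" using c_num_relation[OF j(1)] unfolding c_def by blast
      have ce: "c \<le> e_num a j" using e_num_bounds(1)[OF j(1) deg[OF j(1)]] by (simp add: c_def)
      then have c: "c \<le> m (CARD('d) + j)" using e[OF j(1)] j(2) by simp
      \<comment> \<open>the multiplicities after the exchange of \<open>c\<close> copies of \<open>a\<^sub>d\<^sub>+\<^sub>j\<close> for \<open>r\<close>\<close>
      define q where "q i = m i + (if i \<in> {1..CARD('d)} then r i else 0) - (if i = CARD('d) + j then c else 0)" for i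
      \<comment> \<open>a weighted count, needed with \<open>g\<close> a coordinate of the generators and with \<open>g = 1\<close>\<close>
      have exchange: "(\<Sum>i\<in>{1..CARD('d) + s}. q i * g i) + c * g (CARD('d) + j) =
        (\<Sum>i\<in>{1..CARD('d) + s}. m i * g i) + (\<Sum>i\<in>{1..CARD('d)}. r i * g i)" for g :: "nat \<Rightarrow> nat"
      proof -
        have "c * g (CARD('d) + j) = (\<Sum>i\<in>{1..CARD('d) + s}. (if i = CARD('d) + j then c else 0) * g i)"
          using j(1) by (simp add: if_distrib[of "\<lambda>x. x * _"] cong: if_cong)
        moreover have "(\<Sum>i\<in>{1..CARD('d)}. r i * g i) =
          (\<Sum>i\<in>{1..CARD('d) + s}. (if i \<in> {1..CARD('d)} then r i else 0) * g i)"
          by (rule sum.mono_neutral_cong_left) auto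
        moreover have "q i * g i + (if i = CARD('d) + j then c else 0) * g i =
          m i * g i + (if i \<in> {1..CARD('d)} then r i else 0) * g i" for i
          using c by (simp add: q_def distrib_right[symmetric])
        ultimately show ?thesis by (simp add: sum.distrib[symmetric])
      qed
      have "v = (\<Sum>i\<in>{1..CARD('d) + s}. q i *s a i)"
      proof (rule vec_eq_iff[THEN iffD2], rule allI)
        fix k
        have "c * a (CARD('d) + j) $ k = (\<Sum>i\<in>{1..CARD('d)}. r i * a i $ k)"
          using arg_cong[OF r(2), of "\<lambda>v. v $ k"] by simp
        then show "v $ k = (\<Sum>i\<in>{1..CARD('d) + s}. q i *s a i) $ k"
          using exchange[of "\<lambda>i. a i $ k"] by (simp add: m(1))
      qed
      moreover have "Suc n \<le> (\<Sum>i\<in>{1..CARD('d) + s}. q i)"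
        using exchange[of "\<lambda>_. 1"] ce m(2) r(3) by simp
      moreover have "\<exists>i\<in>{1..CARD('d)}. 0 < q i"
      proof -
        have "(\<Sum>i\<in>{1..CARD('d)}. r i) \<noteq> 0" using ce r(1,3) by linarith
        then obtain i where "i \<in> {1..CARD('d)}" "r i \<noteq> 0"
          by (rule sum.not_neutral_contains_not_neutral)
        then show ?thesis using j(1) by (intro bexI[of _ i]) (auto simp: q_def)
      qed
      ultimately show ?thesis unfolding generators_add_long_sums[OF sub] by blast
    qed
  qed
qed

end

section \<open>The reduction theorem\<close>

text \<open>
  A family of \<open>d\<close> vectors that spans a \<open>d\<close>-dimensional space is independent. The extremal
  generators span, because their cone contains the semigroup, which spans.
\<close>
lemma simplicial_generatorsI:
  fixes S :: "(nat ^ 'd) set" and a :: "nat \<Rightarrow> nat ^ 'd"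
  assumes S: "affine_semigroup S" "fully_embedded S"
    and gen: "nat_span (a ` {1..CARD('d) + s}) = S"
    and inj: "inj_on a {1..CARD('d) + s}"
    and rays: "a ` {1..CARD('d)} = extremal_generators S"
  shows "simplicial_generators S a s"
proof -
  have inj_rays: "inj_on a {1..CARD('d)}" using inj_on_subset[OF inj, of "{1..CARD('d)}"] by simp
  have rv_inj: "inj (real_vec :: nat ^ 'd \<Rightarrow> _)" by (rule injI) (simp add: real_vec_def vec_eq_iff)
  have inj': "inj_on (\<lambda>i. real_vec (a i)) {1..CARD('d)}"
    using inj_onD[OF inj_rays injD[OF rv_inj]] by (intro inj_onI)
  have coords: "\<exists>c. (\<forall>i\<in>{1..CARD('d)}. 0 \<le> c i) \<and> real_vec v = (\<Sum>i\<in>{1..CARD('d)}. c i *\<^sub>R real_vec (a i))"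
    if "v \<in> S" for v
  proof -
    have "real_vec v \<in> cone_of S" using that by (simp add: cone_of_eq_hull hull_inc)
    then have "real_vec v \<in> cone_of (a ` {1..CARD('d)})"
      using cone_of_extremal_generators[OF S(1)] rays by auto
    then obtain F c where F: "real_vec v = (\<Sum>w\<in>F. c w *\<^sub>R real_vec w)" "finite F"
      "F \<subseteq> a ` {1..CARD('d)}" "\<forall>w\<in>F. 0 \<le> c w" unfolding cone_of_def by blast
    have "real_vec v = (\<Sum>w\<in>a ` {1..CARD('d)}. (if w \<in> F then c w else 0) *\<^sub>R real_vec w)"
      unfolding F(1) by (rule sum.mono_neutral_cong_left) (use F in auto)
    also have "\<dots> = (\<Sum>i\<in>{1..CARD('d)}. (if a i \<in> F then c (a i) else 0) *\<^sub>R real_vec (a i))"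
      using inj_rays by (simp add: sum.reindex)
    finally show ?thesis using F(4) by (intro exI[of _ "\<lambda>i. if a i \<in> F then c (a i) else 0"]) simp
  qed
  let ?B = "(\<lambda>i. real_vec (a i)) ` {1..CARD('d)}"
  have "real_vec ` S \<subseteq> span ?B"
  proof
    fix x assume "x \<in> real_vec ` S"
    then obtain c where "x = (\<Sum>i\<in>{1..CARD('d)}. c i *\<^sub>R real_vec (a i))" using coords by blast
    then show "x \<in> span ?B" by (simp only:) (intro span_sum span_scale span_base imageI)
  qed
  then have "UNIV \<subseteq> span ?B"
    using S(2) span_minimal[OF _ subspace_span] unfolding fully_embedded_def by blast
  moreover have "card ?B \<le> dim (UNIV :: (real ^ 'd) set)"
    using card_image[OF inj'] by (simp add: dim_UNIV)
  ultimately have indep: "independent ?B"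
    by (intro card_le_dim_spanning[of ?B UNIV]) auto
  show ?thesis
  proof
    fix c i assume *: "(\<Sum>i\<in>{1..CARD('d)}. c i *\<^sub>R real_vec (a i)) = 0" "i \<in> {1..CARD('d)}"
    define u where "u = (\<lambda>w. c (the_inv_into {1..CARD('d)} (\<lambda>i. real_vec (a i)) w))"
    have u: "u (real_vec (a i)) = c i" if "i \<in> {1..CARD('d)}" for i
      using the_inv_into_f_f[OF inj' that] by (simp add: u_def)
    have "(\<Sum>w\<in>?B. u w *\<^sub>R w) = (\<Sum>i\<in>{1..CARD('d)}. u (real_vec (a i)) *\<^sub>R real_vec (a i))"
      using sum.reindex[OF inj', of "\<lambda>w. u w *\<^sub>R w"] by simp
    also have "\<dots> = 0" using *(1) u by simp
    finally have "u (real_vec (a i)) = 0"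
      using independentD[OF indep finite_imageI[OF finite_atLeastAtMost] order_refl] *(2) by blast
    then show "c i = 0" using u[OF *(2)] by simp
  qed (use gen inj coords in blast)+
qed

theorem theorem2p2:
  fixes S :: "(nat ^ 'd) set" and a :: "nat \<Rightarrow> nat ^ 'd" and s :: nat
    and R :: "((nat ^ 'd) \<Rightarrow>\<^sub>0 'k::field) ring"
  assumes "affine_semigroup S"
    and "fully_embedded S"
    and "simplicial S"
    and "minimal_generating_set S (a ` {1..CARD('d) + s})"
    and "inj_on a {1..CARD('d) + s}"
    and "a ` {1..CARD('d)} = extremal_generators S"
  defines "R \<equiv> semigroup_ring S"
  defines "M \<equiv> Idl\<^bsub>R\<^esub> (monomial ` a ` {1..CARD('d) + s})"
  defines "I \<equiv> Idl\<^bsub>R\<^esub> (monomial ` a ` {1..CARD('d)})"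
  defines "l \<equiv> Max (e_num a ` {1..s})"
  shows "((\<forall>j\<in>{1..s}. deg a (a (CARD('d) + j)) \<ge> 1) \<longleftrightarrow> reduction_ideal R M I)
    \<and> (1 \<le> s \<and> reduction_ideal R M I \<longrightarrow>
         int (reduction_number R M I) \<le> int s * int l - 1)"
proof -
  interpret simplicial_generators S a s
    using assms(1-6) by (intro simplicial_generatorsI) (simp_all add: minimal_generating_set_def)
  note step_iff = reduction_step_iff[where 'k = 'k, folded R_def, folded M_def I_def]
  have sub: "{1..CARD('d)} \<subseteq> {1..CARD('d) + s}" by auto
  interpret R: cring R unfolding R_def by (rule cring_semigroup_ring[OF S_submonoid])
  have "ideal I R" unfolding I_def
    using generator_mem sub by (intro R.genideal_ideal) (auto simp: R_def monomial_supported_iff)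
  moreover have "I \<subseteq> M"
    unfolding I_def M_def R_def genideal_generators[OF sub] genideal_generators[OF order_refl]
    using sub by (intro supported_in_mono set_plus_mono2 image_mono) auto
  ultimately have red_iff: "reduction_ideal R M I \<longleftrightarrow>
      (\<exists>n0. \<forall>n\<ge>n0. long_sums (Suc n) = (a ` {1..CARD('d)} + S) + long_sums n)"
    unfolding reduction_ideal_def step_iff eventually_sequentially by blast
  have step: "long_sums (Suc n) = (a ` {1..CARD('d)} + S) + long_sums n"
    if "\<forall>j\<in>{1..s}. deg a (a (CARD('d) + j)) \<ge> 1" "s * (l - 1) \<le> n" for n
    using that by (intro reduction_step_of_deg_ge_1[of l]) (auto simp: l_def)
  have equiv: "(\<forall>j\<in>{1..s}. deg a (a (CARD('d) + j)) \<ge> 1) \<longleftrightarrow> reduction_ideal R M I"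
  proof
    assume "\<forall>j\<in>{1..s}. deg a (a (CARD('d) + j)) \<ge> 1"
    then show "reduction_ideal R M I" unfolding red_iff using step by blast
  next
    assume "reduction_ideal R M I"
    then obtain n0 where "\<And>n. n0 \<le> n \<Longrightarrow> long_sums (Suc n) = (a ` {1..CARD('d)} + S) + long_sums n"
      unfolding red_iff by blast
    then show "\<forall>j\<in>{1..s}. deg a (a (CARD('d) + j)) \<ge> 1"
      by (intro ballI deg_ge_1_of_reduction[of n0]) auto
  qed
  moreover have "int (reduction_number R M I) \<le> int s * int l - 1" if "1 \<le> s" "reduction_ideal R M I"
  proof -
    have deg: "\<forall>j\<in>{1..s}. deg a (a (CARD('d) + j)) \<ge> 1" using that(2) equiv by simp
    have "2 \<le> e_num a 1" using e_num_bounds(2)[OF _ bspec[OF deg]] that(1) by simp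
    also have "\<dots> \<le> l" unfolding l_def using that(1) by (intro Max_ge) auto
    finally have "1 * 2 \<le> s * l" using that(1) by (intro mult_le_mono)
    moreover have "s * (l - 1) \<le> s * l - 1" using that(1) by (simp add: diff_mult_distrib2)
    then have "\<forall>n\<ge>s * l - 1. M [^]\<^bsub>ideals_set R\<^esub> (n + 1) = I \<cdot>\<^bsub>R\<^esub> (M [^]\<^bsub>ideals_set R\<^esub> n)"
      unfolding step_iff using step[OF deg] by auto
    ultimately have "reduction_number R M I \<le> s * l - 1"
      unfolding reduction_number_def by (intro Least_le) simp
    then have "int (reduction_number R M I) \<le> int (s * l - 1)" by simp
    also have "\<dots> = int s * int l - 1" using \<open>1 * 2 \<le> s * l\<close> by (subst of_nat_mult[symmetric]) linarith
    finally show ?thesis .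
  qed
  ultimately show ?thesis by blast
qed

end
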